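(* Let $\mathcal{W}$ be a standard sequence of generating words with bounded spacers such that the minimal Ferenczi subshift $(X_{\mathcal{W}}, S)$ is aperiodic, and let $\mu$ be its unique invariant probability measure. 1. If $d_{\mathcal{W}_\mu} = d_{\mathcal{W}}$ (i.e., if $\boldsymbol{\tau}_{\mathcal{W}}$ is of exact finite rank), then all measurable eigenvalues of $(X_{\mathcal{W}}, S)$ with respect to $\mu$ are continuous. 2. If $d_{\mathcal{W}_\mu} \ge 2$, then the system $(X_{\mathcal{W}}, S)$ has no irrational measurable eigenvalues with respect to $\mu$.
   Context: $S$ is the shift; a subshift is aperiodic if it is nonempty and contains no shift-periodic point. Ferenczi subshifts. Given nonnegative integers $(q_n)_{n \ge 0}$ (cutting parameters) and $(a_{n,i} : n \ge 0, 0 \le i < q_n)$ (spacer parameters), the sequence of generating words $\mathcal{W} = (w_n)_{n \ge 0}$ over $\{0,1\}$ is $w_0 = 0$, $w_{n+1} = w_n 1^{a_{n,0}} w_n 1^{a_{n,1}} \cdots w_n 1^{a_{n,q_n-1}} w_n$. $X_{\mathcal{W}}$ is the set of $x \in \{0,1\}^{\mathbb{Z}}$ every finite factor of which is a factor of some $w_n$. $\mathcal{W}$ is standard if $q_n \ge 2$ for all $n$. If the spacers are bounded, $(X_{\mathcal{W}},S)$ is minimal; it is uniquely ergodic. Directive sequence. $\mathcal{A}_0 = \{0,1\}$, $\mathcal{A}_n = \{a_{N,i} : N \ge n-1, 0 \le i < q_N\}$ for $n \ge 1$. $\boldsymbol{\tau}_{\mathcal{W}} = (\tau_n : \mathcal{A}_{n+1}^*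 \to \mathcal{A}_n^* )_{n\ge 0}$ consists of the morphisms $\tau_0(a) = 01^a$ and, for $n \ge 1$, $\tau_n(a) = a_{n-1,1} \cdots a_{n-1,q_{n-1}-1}\, a\, a_{n-1,0}$. $\tau_{[n,N)} = \tau_n \circ \cdots \circ \tau_{N-1}$. The sets $\mathcal{A}_n$ ($n\ge1$) are decreasing, with eventual constant value $\mathcal{A}_{\mathcal{W}}$, attained for $n \ge n_0$ ($n_0\ge1$); $d_{\mathcal{W}} = |\mathcal{A}_{\mathcal{W}}|$. Towers. $X^{(n)}$ is the set of $x \in \mathcal{A}_n^{\mathbb{Z}}$ all of whose finite factors occur in some $\tau_{[n,N)}(a)$, $N>n$, $a \in \mathcal{A}_N$ (so $X^{(0)}=X_{\mathcal{W}}$). For $a \in \mathcal{A}_n$, $\mathcal{T}_n(a) = \bigcup_{0 \le k < |\tau_{[0,n)}(a)|} S^k \tau_{[0,n)}(\{x \in X^{(n)} : x_0=a\})$. Clean. $\boldsymbol{\tau}_{\mathcal{W}}$ is clean with respect to $\mu$ if there are $c>0$ and $\mathcal{A}_\mu \subseteq \mathcal{A}_{\mathcal{W}}$ with $\mu(\mathcal{T}_n(a)) \ge c$ for all $n \ge n_0$, $a \in \mathcal{A}_\mu$, and $\mu(\mathcal{T}_n(a)) \to 0$ as $n\to+\infty$ for $a \in \mathcal{A}_{\mathcal{W}} \setminus \mathcal{A}_\mu$. Convention: $\boldsymbol{\tau}_{\mathcal{W}}$ is assumed clean with respect to $\mu$, replacing it if necessary by a contraction $(\tau_{[n_k,n_{k+1})})_{k\ge0}$,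 $0=n_0'=n_{k}|_{k=0}<n_1<n_2<\cdots$ (whose towers are the $\mathcal{T}_{n_k}(a)$, so that the conditions above are required along the levels $n_k$ only), which is always possible. Then $d_{\mathcal{W}_\mu} = |\mathcal{A}_\mu|$; exact finite rank means $\mathcal{A}_\mu = \mathcal{A}_{\mathcal{W}}$. Eigenvalues. $\lambda \in \mathbb{C}$ is a measurable (resp. continuous) eigenvalue if there is a nonzero $f \in L^2(X_{\mathcal{W}},\mu)$ (resp. a nonzero continuous $f: X_{\mathcal{W}} \to \mathbb{C}$) with $f \circ S = \lambda f$. Such $\lambda$ have modulus 1; $\lambda = \exp(2\pi i \alpha)$ is irrational if $\alpha$ is irrational. *)

theory Defs
  imports "HOL-Probability.Probability" "HOL-Library.Sublist"
begin

text \<open>All alphabets are sets of natural numbers, so that two-sided sequences over any of them have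
  the type \<open>int \<Rightarrow> nat\<close>. With the discrete topology on \<open>nat\<close> this type carries the product topology,
  and \<open>borel\<close> is the corresponding Borel sigma-algebra.\<close>

definition shift_map :: "(int \<Rightarrow> nat) \<Rightarrow> int \<Rightarrow> nat" where
  "shift_map x = (\<lambda>i. x (i + 1))"

text \<open>Sequences over \<open>A\<close> all of whose finite factors occur in some word of \<open>L\<close>. The list \<open>[i..j]\<close> is
  the integer interval, so \<open>map x [i..j]\<close> is the factor \<open>x\<^sub>i \<dots> x\<^sub>j\<close> (empty for \<open>j < i\<close>).\<close>

definition subshift_of :: "nat set \<Rightarrow> nat list set \<Rightarrow> (int \<Rightarrow> nat) set" where
  "subshift_of A L = {x. range x \<subseteq> A \<and> (\<forall>i j. \<exists>w\<in>L. sublist (map x [i..j]) w)}"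

definition aperiodic :: "(int \<Rightarrow> nat) set \<Rightarrow> bool" where
  "aperiodic X \<longleftrightarrow> X \<noteq> {} \<and> (\<forall>x\<in>X. \<forall>p\<ge>1. (shift_map ^^ p) x \<noteq> x)"

text \<open>\<open>\<mu>\<close> is a Borel probability measure on the space \<open>X\<close> itself, so \<open>space \<mu> = X\<close>.\<close>

definition invariant_prob :: "(int \<Rightarrow> nat) set \<Rightarrow> (int \<Rightarrow> nat) measure \<Rightarrow> bool" where
  "invariant_prob X \<mu> \<longleftrightarrow>
     prob_space \<mu> \<and> sets \<mu> = sets (restrict_space borel X) \<and>
     shift_map \<in> measurable \<mu> \<mu> \<and> distr \<mu> \<mu> shift_map = \<mu>"

definition measurable_eigenvalue :: "(int \<Rightarrow> nat) measure \<Rightarrow> complex \<Rightarrow> bool" where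
  "measurable_eigenvalue \<mu> l \<longleftrightarrow>
     (\<exists>f :: (int \<Rightarrow> nat) \<Rightarrow> complex.
        f \<in> borel_measurable \<mu> \<and> integrable \<mu> (\<lambda>x. (cmod (f x))\<^sup>2) \<and>
        \<not> (AE x in \<mu>. f x = 0) \<and> (AE x in \<mu>. f (shift_map x) = l * f x))"

definition continuous_eigenvalue :: "(int \<Rightarrow> nat) set \<Rightarrow> complex \<Rightarrow> bool" where
  "continuous_eigenvalue X l \<longleftrightarrow>
     (\<exists>f :: (int \<Rightarrow> nat) \<Rightarrow> complex.
        continuous_on X f \<and> (\<exists>x\<in>X. f x \<noteq> 0) \<and> (\<forall>x\<in>X. f (shift_map x) = l * f x))"

text \<open>Throughout, \<open>q\<close> are the cutting parameters and \<open>s\<close> the spacer parameters; only the values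
  \<open>s n i\<close> with \<open>i < q n\<close> matter.\<close>

primrec gen_word :: "(nat \<Rightarrow> nat) \<Rightarrow> (nat \<Rightarrow> nat \<Rightarrow> nat) \<Rightarrow> nat \<Rightarrow> nat list" where
  "gen_word q s 0 = [0]"
| "gen_word q s (Suc n) =
     concat (map (\<lambda>i. gen_word q s n @ replicate (s n i) 1) [0..<q n]) @ gen_word q s n"

definition ferenczi_subshift :: "(nat \<Rightarrow> nat) \<Rightarrow> (nat \<Rightarrow> nat \<Rightarrow> nat) \<Rightarrow> (int \<Rightarrow> nat) set" where
  "ferenczi_subshift q s = subshift_of {0, 1} (range (gen_word q s))"

definition standard :: "(nat \<Rightarrow> nat) \<Rightarrow> bool" where
  "standard q \<longleftrightarrow> (\<forall>n. q n \<ge> 2)"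

definition bounded_spacers :: "(nat \<Rightarrow> nat) \<Rightarrow> (nat \<Rightarrow> nat \<Rightarrow> nat) \<Rightarrow> bool" where
  "bounded_spacers q s \<longleftrightarrow> (\<exists>B. \<forall>n. \<forall>i<q n. s n i \<le> B)"

definition alphabet :: "(nat \<Rightarrow> nat) \<Rightarrow> (nat \<Rightarrow> nat \<Rightarrow> nat) \<Rightarrow> nat \<Rightarrow> nat set" where
  "alphabet q s n = (if n = 0 then {0, 1} else {s N i | N i. N \<ge> n - 1 \<and> i < q N})"

text \<open>For \<open>n \<ge> 1\<close> the alphabets decrease, and for bounded spacers they are finite, hence eventually
  constant.\<close>

definition stab_level :: "(nat \<Rightarrow> nat) \<Rightarrow> (nat \<Rightarrow> nat \<Rightarrow> nat) \<Rightarrow> nat" where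
  "stab_level q s = (LEAST n. n \<ge> 1 \<and> (\<forall>m\<ge>n. alphabet q s m = alphabet q s n))"

definition eventual_alphabet :: "(nat \<Rightarrow> nat) \<Rightarrow> (nat \<Rightarrow> nat \<Rightarrow> nat) \<Rightarrow> nat set" where
  "eventual_alphabet q s = alphabet q s (stab_level q s)"

definition tau :: "(nat \<Rightarrow> nat) \<Rightarrow> (nat \<Rightarrow> nat \<Rightarrow> nat) \<Rightarrow> nat \<Rightarrow> nat \<Rightarrow> nat list" where
  "tau q s n a =
     (if n = 0 then 0 # replicate a 1
      else map (s (n - 1)) [1..<q (n - 1)] @ [a, s (n - 1) 0])"

definition apply_word :: "(nat \<Rightarrow> nat list) \<Rightarrow> nat list \<Rightarrow> nat list" where
  "apply_word \<sigma> u = concat (map \<sigma> u)"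

text \<open>The letter images of \<open>\<tau>\<^sub>n \<circ> \<dots> \<circ> \<tau>\<^sub>N\<^sub>-\<^sub>1\<close> (the identity if \<open>N \<le> n\<close>).\<close>

definition tau_range ::
  "(nat \<Rightarrow> nat) \<Rightarrow> (nat \<Rightarrow> nat \<Rightarrow> nat) \<Rightarrow> nat \<Rightarrow> nat \<Rightarrow> nat \<Rightarrow> nat list" where
  "tau_range q s n N a = foldr (\<lambda>k. apply_word (tau q s k)) [n..<N] [a]"

text \<open>The two-sided sequence \<open>\<dots> \<sigma>(x\<^sub>-\<^sub>1) . \<sigma>(x\<^sub>0) \<sigma>(x\<^sub>1) \<dots>\<close>, where \<open>\<sigma>(x\<^sub>0)\<close> starts at position \<open>0\<close>. It is only
  meaningful for non-erasing \<open>\<sigma>\<close>: then \<open>\<sigma>(x\<^sub>0 \<dots> x\<^sub>m)\<close> has more than \<open>m\<close> letters and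
  \<open>\<sigma>(x\<^sub>m \<dots> x\<^sub>-\<^sub>1)\<close>, for negative \<open>m\<close>, has at least \<open>-m\<close> letters.\<close>

definition apply_biinf :: "(nat \<Rightarrow> nat list) \<Rightarrow> (int \<Rightarrow> nat) \<Rightarrow> int \<Rightarrow> nat" where
  "apply_biinf \<sigma> x m =
     (if m \<ge> 0 then apply_word \<sigma> (map x [0..m]) ! nat m
      else (let u = apply_word \<sigma> (map x [m..-1]) in u ! (length u - nat (- m))))"

definition level_subshift ::
  "(nat \<Rightarrow> nat) \<Rightarrow> (nat \<Rightarrow> nat \<Rightarrow> nat) \<Rightarrow> nat \<Rightarrow> (int \<Rightarrow> nat) set" where
  "level_subshift q s n =
     subshift_of (alphabet q s n) {tau_range q s n N a | N a. N > n \<and> a \<in> alphabet q s N}"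

definition tower ::
  "(nat \<Rightarrow> nat) \<Rightarrow> (nat \<Rightarrow> nat \<Rightarrow> nat) \<Rightarrow> nat \<Rightarrow> nat \<Rightarrow> (int \<Rightarrow> nat) set" where
  "tower q s n a =
     (\<Union>k<length (tau_range q s 0 n a).
        (shift_map ^^ k) ` apply_biinf (tau_range q s 0 n) ` {x \<in> level_subshift q s n. x 0 = a})"

text \<open>A contraction of the directive sequence is given by its levels \<open>0 = lv 0 < lv 1 < \<dots>\<close>; the
  choice \<open>lv k = k\<close> is the directive sequence itself.\<close>

definition contraction_levels :: "(nat \<Rightarrow> nat) \<Rightarrow> bool" where
  "contraction_levels lv \<longleftrightarrow> strict_mono lv \<and> lv 0 = 0"

text \<open>The contraction along \<open>lv\<close> is clean with respect to \<open>\<mu>\<close>, with \<open>A\<^sub>\<mu> = A\<close>.\<close>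

definition clean_along ::
  "(nat \<Rightarrow> nat) \<Rightarrow> (nat \<Rightarrow> nat \<Rightarrow> nat) \<Rightarrow> (int \<Rightarrow> nat) measure \<Rightarrow> (nat \<Rightarrow> nat) \<Rightarrow> nat set \<Rightarrow> bool" where
  "clean_along q s \<mu> lv A \<longleftrightarrow>
     A \<subseteq> eventual_alphabet q s \<and>
     (\<exists>c>0. \<forall>k. lv k \<ge> stab_level q s \<longrightarrow> (\<forall>a\<in>A. measure \<mu> (tower q s (lv k) a) \<ge> c)) \<and>
     (\<forall>a \<in> eventual_alphabet q s - A. (\<lambda>k. measure \<mu> (tower q s (lv k) a)) \<longlonglongrightarrow> 0)"

end

theory Submission
  imports Defs
begin

text \<open>For \<open>x \<in> X\<close> call \<open>i\<close> a cut of level \<open>n\<close> if the right half of \<open>x\<close> from \<open>i\<close> on is an infinite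
  concatenation of words \<open>w\<^sub>n 1\<^sup>b\<close>. Aperiodicity forces distinct cuts of level \<open>n\<close> to be at least
  \<open>h\<^sub>n = |w\<^sub>n|\<close> apart: two overlapping parsings into \<open>w\<^sub>n\<^sub>+\<^sub>1\<close>-blocks would make the sequence of spacers
  periodic. Hence the cuts split \<open>X\<close> into Rokhlin towers of height about \<open>h\<^sub>n\<close> whose levels determine
  longer and longer windows of \<open>x\<close>.

  If \<open>f \<circ> S = \<lambda> f\<close>, then by a density point argument \<open>f\<close> is almost constant on most of some level of
  each high tower. If moreover the spacer \<open>a\<close> follows \<open>w\<^sub>n\<close> with relative frequency bounded below, then \<open>S\<close> to the
  power \<open>h\<^sub>n + a\<close> maps a substantial part of this level to itself, so \<open>\<lambda>\<close> to the power \<open>h\<^sub>n + a\<close> is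
  close to 1. Two such spacers \<open>a \<noteq> b\<close> make \<open>\<lambda>\<close> a root of unity of order dividing \<open>a - b\<close>. An aperiodic
  system always has at least two recurring spacers; if all of them have frequency bounded below, then
  for some \<open>n\<close> the value at \<open>h\<^sub>n + a\<close> is exactly 1 for all of them, and \<open>\<lambda>\<close> to the power of the
  distance to any previous cut of level \<open>n\<close> is a continuous eigenfunction.\<close>

section \<open>Parsing sequences into blocks\<close>

definition matches :: "(int \<Rightarrow> nat) \<Rightarrow> int \<Rightarrow> nat list \<Rightarrow> bool" where
  "matches x i w \<longleftrightarrow> (\<forall>k<length w. x (i + int k) = w ! k)"

lemma matchesD: "matches x i w \<Longrightarrow> k < length w \<Longrightarrow> x (i + int k) = w ! k"
  by (simp add: matches_def)

lemma matches_append: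
  "matches x i (u @ v) \<longleftrightarrow> matches x i u \<and> matches x (i + int (length u)) v"
proof
  assume *: "matches x i (u @ v)"
  have "x (i + int (length u) + int k) = v ! k" if "k < length v" for k
    using *[unfolded matches_def, rule_format, of "length u + k"] that by (simp add: add.assoc)
  moreover have "x (i + int k) = u ! k" if "k < length u" for k
    using *[unfolded matches_def, rule_format, of k] that by (simp add: nth_append)
  ultimately show "matches x i u \<and> matches x (i + int (length u)) v"
    by (simp add: matches_def)
next
  assume *: "matches x i u \<and> matches x (i + int (length u)) v"
  show "matches x i (u @ v)"
    unfolding matches_def
  proof (intro allI impI)
    fix k assume k: "k < length (u @ v)"
    show "x (i + int k) = (u @ v) ! k"
    proof (cases "k < length u")
      case True
      then show ?thesis using * by (simp add: matches_def nth_append)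
    next
      case False
      have eq: "i + int (length u) + int (k - length u) = i + int k" using False by simp
      have "x (i + int (length u) + int (k - length u)) = v ! (k - length u)"
        using * k False by (intro matchesD) simp_all
      then show ?thesis unfolding eq using False by (simp add: nth_append)
    qed
  qed
qed

lemma matches_shift: "matches (shift_map x) i w \<longleftrightarrow> matches x (i + 1) w"
  by (simp add: matches_def shift_map_def algebra_simps)

lemma shift_map_funpow: "(shift_map ^^ k) x i = x (i + int k)"
  by (induction k arbitrary: i) (simp_all add: shift_map_def algebra_simps)

text \<open>Pigeonhole form of compactness: if every \<open>b\<close> failed at some depth, the one
  that works at the largest of these finitely many depths would contradict antitonicity. It passes
  from parsings of every finite depth to an infinite one.\<close>

lemma uniform_choice:
  fixes P :: "'a \<Rightarrow> nat \<Rightarrow> bool"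
  assumes fin: "finite A" and ex: "\<And>t. \<exists>b\<in>A. P b t"
    and anti: "\<And>b t u. P b u \<Longrightarrow> t \<le> u \<Longrightarrow> P b t"
  shows "\<exists>b\<in>A. \<forall>t. P b t"
proof (rule ccontr)
  assume "\<not> ?thesis"
  then obtain u where u: "\<And>b. b \<in> A \<Longrightarrow> \<not> P b (u b)" by metis
  obtain b where b: "b \<in> A" "P b (Max (u ` A))" using ex by blast
  have "u b \<le> Max (u ` A)" using b fin by simp
  then show False using anti[OF b(2)] u[OF b(1)] by blast
qed

definition block :: "nat list \<Rightarrow> nat \<Rightarrow> nat list" where
  "block w b = w @ replicate b 1"

lemma length_block [simp]: "length (block w b) = length w + b"
  by (simp add: block_def)

text \<open>Finite approximations of \<open>parse\<close> below; they make it a closed condition on \<open>x\<close>.\<close>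

primrec parses :: "nat list \<Rightarrow> nat set \<Rightarrow> (int \<Rightarrow> nat) \<Rightarrow> nat \<Rightarrow> int \<Rightarrow> bool" where
  "parses w A x 0 i = True"
| "parses w A x (Suc t) i =
     (\<exists>b\<in>A. matches x i (block w b) \<and> parses w A x t (i + int (length w + b)))"

definition parse :: "nat list \<Rightarrow> nat set \<Rightarrow> (int \<Rightarrow> nat) \<Rightarrow> int \<Rightarrow> bool" where
  "parse w A x i \<longleftrightarrow> (\<forall>t. parses w A x t i)"

lemma parses_antimono: "parses w A x u i \<Longrightarrow> t \<le> u \<Longrightarrow> parses w A x t i"
proof (induction u arbitrary: t i)
  case (Suc u)
  then show ?case by (cases t) auto
qed simp

text \<open>Koenig's lemma: a first spacer exists for each depth, and finiteness of \<open>A\<close>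
  yields one that serves all depths.\<close>

lemma parse_step:
  assumes "finite A" "parse w A x i"
  shows "\<exists>b\<in>A. matches x i (block w b) \<and> parse w A x (i + int (length w + b))"
proof -
  have "\<exists>b\<in>A. \<forall>t. matches x i (block w b) \<and> parses w A x t (i + int (length w + b))"
  proof (rule uniform_choice[OF assms(1)])
    fix t
    have "parses w A x (Suc t) i" using assms(2) by (simp add: parse_def del: parses.simps)
    then show "\<exists>b\<in>A. matches x i (block w b) \<and> parses w A x t (i + int (length w + b))"
      by simp
  qed (use parses_antimono in blast)
  then show ?thesis by (auto simp: parse_def)
qed

text \<open>The coinduction rule for \<open>parse\<close>: any set of positions closed under reading
  one block consists of parsing positions.\<close>

lemma parse_coinduct:
  assumes "R i"
    and "\<And>i. R i \<Longrightarrow> \<exists>b\<in>A. matches x i (block w b) \<and> R (i + int (length w + b))"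
  shows "parse w A x i"
proof -
  have "R i \<Longrightarrow> parses w A x t i" for t i
  proof (induction t arbitrary: i)
    case (Suc t)
    then show ?case using assms(2)[OF Suc.prems] by auto
  qed simp
  then show ?thesis using assms(1) by (simp add: parse_def)
qed

lemma parses_shift: "parses w A (shift_map x) t i \<longleftrightarrow> parses w A x t (i + 1)"
  by (induction t arbitrary: i) (simp_all add: matches_shift algebra_simps)

lemma parse_shift: "parse w A (shift_map x) i \<longleftrightarrow> parse w A x (i + 1)"
  by (simp add: parse_def parses_shift)

lemma parse_funpow_shift:
  "parse w A ((shift_map ^^ k) x) i \<longleftrightarrow> parse w A x (i + int k)"
  by (induction k arbitrary: i) (simp_all add: parse_shift algebra_simps)

lemma parses_blocks:
  assumes "set bs \<subseteq> A" "matches x i (concat (map (block w) bs))"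
    "parses w A x t (i + int (length (concat (map (block w) bs))))"
  shows "parses w A x (length bs + t) i"
  using assms
proof (induction bs arbitrary: i)
  case (Cons b bs)
  have "parses w A x (length bs + t) (i + int (length w + b))"
    using Cons by (intro Cons.IH) (auto simp: matches_append algebra_simps)
  then show ?case using Cons.prems by (auto simp: matches_append)
qed simp

text \<open>A \<open>w'\<close>-block splits into at least one \<open>w\<close>-block, so
  \<open>t\<close> coarse blocks supply at least \<open>t\<close> fine ones. In the splitting only
  the last spacer \<open>b\<close> is free; \<open>bs\<close> is prescribed.\<close>

lemma parses_refine:
  assumes fin: "finite A'"
    and w': "\<And>b. b \<in> A' \<Longrightarrow> block w' b = concat (map (block w) (bs @ [b]))"
    and sub: "set bs \<subseteq> A" "A' \<subseteq> A"
    and p: "parse w' A' x i"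
  shows "parse w A x i"
proof -
  have "parse w' A' x i \<Longrightarrow> parses w A x t i" for t i
  proof (induction t arbitrary: i)
    case (Suc t)
    obtain b where b: "b \<in> A'" "matches x i (block w' b)" "parse w' A' x (i + int (length w' + b))"
      using parse_step[OF fin Suc.prems] by blast
    have "parses w A x (length (bs @ [b]) + t) i"
    proof (rule parses_blocks)
      show "set (bs @ [b]) \<subseteq> A" using sub b by auto
      show "matches x i (concat (map (block w) (bs @ [b])))" using b w' by metis
      show "parses w A x t (i + int (length (concat (map (block w) (bs @ [b])))))"
        using Suc.IH[OF b(3)] by (metis w' b(1) length_block)
    qed
    then show ?case by (rule parses_antimono) simp
  qed simp
  then show ?thesis using p by (simp add: parse_def)
qed

text \<open>Blocks begin with 0 and spacers consist of 1, so the distance to the next 0 is the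
  spacer. The next block start thus becomes a function of \<open>x\<close> and
  \<open>i\<close>.\<close>

definition gap :: "(int \<Rightarrow> nat) \<Rightarrow> int \<Rightarrow> nat" where
  "gap x i = (LEAST b. x (i + int b) = 0)"

lemma gap_eq:
  assumes "matches x i (replicate b 1)" "x (i + int b) = 0"
  shows "gap x i = b"
  unfolding gap_def
proof (rule Least_equality)
  fix c assume "x (i + int c) = 0"
  then show "b \<le> c" using matchesD[OF assms(1), of c] by (cases "b \<le> c") simp_all
qed fact

definition next_pos :: "nat list \<Rightarrow> (int \<Rightarrow> nat) \<Rightarrow> int \<Rightarrow> int" where
  "next_pos w x i = i + int (length w + gap x (i + int (length w)))"

locale parsing =
  fixes w :: "nat list" and A :: "nat set"
  assumes nonempty: "w \<noteq> []" and hd0: "w ! 0 = 0" and fin: "finite A"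
begin

lemma parse_zero: "parse w A x i \<Longrightarrow> x i = 0"
  using parse_step[OF fin, of w x i] nonempty hd0 matchesD[of x i w 0]
  by (auto simp: matches_append block_def)

lemma block_gap:
  assumes "matches x i (block w b)" "x (i + int (length w + b)) = 0"
  shows "gap x (i + int (length w)) = b"
  using assms by (intro gap_eq) (auto simp: block_def matches_append algebra_simps)

lemma parse_next:
  assumes "parse w A x i"
  shows "gap x (i + int (length w)) \<in> A" "parse w A x (next_pos w x i)"
    "matches x i (block w (gap x (i + int (length w))))"
proof -
  obtain b where b: "b \<in> A" "matches x i (block w b)" "parse w A x (i + int (length w + b))"
    using parse_step[OF fin assms] by blast
  have "gap x (i + int (length w)) = b"
    using block_gap b parse_zero by blast
  then show "gap x (i + int (length w)) \<in> A" "parse w A x (next_pos w x i)"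
    "matches x i (block w (gap x (i + int (length w))))"
    using b by (simp_all add: next_pos_def)
qed

lemma parse_next_pow: "parse w A x i \<Longrightarrow> parse w A x ((next_pos w x ^^ t) i)"
  by (induction t) (auto intro: parse_next)

lemma next_pos_ge: "i + int (length w) \<le> next_pos w x i"
  by (simp add: next_pos_def)

lemma next_pow_ge: "(next_pos w x ^^ t) i \<ge> i + int t"
proof (induction t)
  case (Suc t)
  have "length w > 0" using nonempty by simp
  then show ?case using Suc next_pos_ge[of "(next_pos w x ^^ t) i" x] by (simp only: funpow.simps o_apply)
qed simp

text \<open>The walk from \<open>i\<close> cannot jump over \<open>j\<close>: by separation
  \<open>j\<close> lies beyond the copy of \<open>w\<close> at \<open>i\<close>, and inside the
  following run of spacers the symbol is 1, whereas \<open>x j\<close> is 0.\<close>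

lemma parse_reach:
  assumes sep: "\<And>i j. parse w A x i \<Longrightarrow> parse w A x j \<Longrightarrow> i < j \<Longrightarrow> i + int (length w) \<le> j"
    and "parse w A x i" "parse w A x j" "i \<le> j"
  shows "\<exists>r. j = (next_pos w x ^^ r) i"
  using assms(2-)
proof (induction "nat (j - i)" arbitrary: i rule: less_induct)
  case less
  show ?case
  proof (cases "i = j")
    case True
    then show ?thesis by (intro exI[of _ 0]) simp
  next
    case False
    then have ge: "i + int (length w) \<le> j" using less sep by simp
    have "next_pos w x i \<le> j"
    proof (rule ccontr)
      assume *: "\<not> next_pos w x i \<le> j"
      define k where "k = nat (j - i - int (length w))"
      have "matches x (i + int (length w)) (replicate (gap x (i + int (length w))) 1)"
        using parse_next(3)[OF less(2)] by (simp add: block_def matches_append)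
      then have "x (i + int (length w) + int k) = 1"
        using matchesD[of x "i + int (length w)" _ k] * ge by (simp add: next_pos_def k_def)
      then show False using parse_zero[OF less(3)] ge by (simp add: k_def)
    qed
    moreover have "i < next_pos w x i" using next_pow_ge[of i 1 x] by simp
    ultimately obtain r where "j = (next_pos w x ^^ r) (next_pos w x i)"
      using less(1)[of "next_pos w x i"] parse_next(2)[OF less(2)] less(3) by auto
    then show ?thesis by (intro exI[of _ "Suc r"]) (simp add: funpow_swap1)
  qed
qed

text \<open>The spacers determine \<open>x\<close> to the right of \<open>i\<close>. If they repeat
  with period \<open>T\<close>, then \<open>T\<close> steps of the walk always cover the same
  distance \<open>P\<close>, and blocks at distance \<open>P\<close> coincide.\<close>

lemma periodic_gaps:
  fixes T :: nat
  assumes p: "parse w A x i" and T: "T \<ge> 1"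
    and per: "\<And>t. gap x ((next_pos w x ^^ (t + T)) i + int (length w)) =
                gap x ((next_pos w x ^^ t) i + int (length w))"
  shows "\<exists>P>0. \<forall>m\<ge>i. x (m + P) = x m"
proof -
  let ?e = "\<lambda>t. (next_pos w x ^^ t) i"
  define P where "P = ?e T - i"
  have P: "P > 0" using next_pow_ge[of i T x] T by (simp add: P_def)
  have shift: "?e (t + T) = ?e t + P" for t
  proof (induction t)
    case (Suc t)
    have "?e (Suc t + T) = next_pos w x (?e (t + T))" by simp
    also have "\<dots> = next_pos w x (?e t) + P"
      unfolding next_pos_def[of w x "?e (t + T)"] next_pos_def[of w x "?e t"] per[of t]
      using Suc by simp
    finally show ?case by simp
  qed (simp add: P_def)
  have "x (m + P) = x m" if m: "m \<ge> i" for m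
  proof -
    have "\<exists>t. m < ?e t" using next_pow_ge[of i "nat (m - i) + 1" x] m by (intro exI[of _ "nat (m - i) + 1"]) simp
    \<comment> \<open>The first block start beyond \<open>m\<close>; hence \<open>m\<close> lies in
      the block that begins one step earlier.\<close>
    define t where "t = (LEAST t. m < ?e t)"
    have t: "m < ?e t" unfolding t_def by (rule LeastI_ex) fact
    with m have "t \<noteq> 0" by (cases t) auto
    then obtain u where u: "t = Suc u" by (cases t) auto
    have le: "?e u \<le> m" using not_less_Least[of u "\<lambda>t. m < ?e t"] u t_def by auto
    define k where "k = nat (m - ?e u)"
    define b where "b = gap x (?e u + int (length w))"
    have k: "k < length w + b" using t u le by (simp add: k_def b_def next_pos_def)
    have "matches x (?e u) (block w b)"
      unfolding b_def by (rule parse_next(3)[OF parse_next_pow[OF p]])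
    moreover have "matches x (?e (u + T)) (block w b)"
      unfolding b_def per[of u, symmetric] by (rule parse_next(3)[OF parse_next_pow[OF p]])
    ultimately have "x (?e u + int k) = x (?e (u + T) + int k)"
      using k by (simp add: matches_def)
    then show ?thesis using shift[of u] le by (simp add: k_def algebra_simps)
  qed
  then show ?thesis using P by blast
qed

end

text \<open>If a separated parsing into \<open>w\<close>-blocks admitted two overlapping parsings into \<open>w'\<close>-blocks, the
  free spacer of each would be prescribed by the other, so all spacers would repeat.\<close>

lemma overlap_periodic:
  assumes "parsing w A" "finite A'"
    and w': "\<And>b. b \<in> A' \<Longrightarrow> block w' b = concat (map (block w) (bs @ [b]))"
    and sub: "set bs \<subseteq> A" "A' \<subseteq> A"
    and sep: "\<And>i j. parse w A x i \<Longrightarrow> parse w A x j \<Longrightarrow> i < j \<Longrightarrow> i + int (length w) \<le> j"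
    and i: "parse w' A' x i" and j: "parse w' A' x j"
    and ij: "i < j" "j < i + int (length w')"
  shows "\<exists>P>0. \<forall>m\<ge>j. x (m + P) = x m"
proof -
  interpret parsing w A by fact
  let ?n = "\<lambda>t. next_pos w x ^^ t" and ?g = "\<lambda>i. gap x (i + int (length w))"
  let ?q = "length bs"
  have sub': "parse w A x i" if "parse w' A' x i" for i
    using parses_refine[OF assms(2) w' sub that] by simp
  \<comment> \<open>The 0 demanded at the end marks where the last spacer stops; every earlier
    spacer is stopped by the first letter of the next \<open>w\<close>.\<close>
  have walk: "(?n (length cs)) i = i + int (length (concat (map (block w) cs)))
      \<and> (\<forall>t<length cs. ?g (?n t i) = cs ! t)"
    if "matches x i (concat (map (block w) cs))"
       "x (i + int (length (concat (map (block w) cs)))) = 0" for cs i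
    using that
  proof (induction cs arbitrary: i)
    case (Cons c cs)
    have z: "x (i + int (length w + c)) = 0"
    proof (cases cs)
      case Nil
      then show ?thesis using Cons.prems by simp
    next
      case (Cons d ds)
      then have "matches x (i + int (length w + c)) w"
        using Cons.prems(1) by (simp add: block_def matches_append add.assoc)
      then show ?thesis using nonempty hd0 matchesD[of x _ w 0] by simp
    qed
    have c: "?g i = c" using Cons.prems(1) z by (intro block_gap) (auto simp: matches_append)
    then have nx: "next_pos w x i = i + int (length w + c)" by (simp add: next_pos_def)
    have IH: "(?n (length cs)) (next_pos w x i) =
          next_pos w x i + int (length (concat (map (block w) cs)))
        \<and> (\<forall>t<length cs. ?g (?n t (next_pos w x i)) = cs ! t)"
      unfolding nx using Cons.prems by (intro Cons.IH) (auto simp: matches_append algebra_simps)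
    have "?g (?n t i) = (c # cs) ! t" if "t < length (c # cs)" for t
      using that IH c by (cases t) (auto simp: funpow_swap1)
    moreover have "(?n (length (c # cs))) i = i + int (length (concat (map (block w) (c # cs))))"
      using IH nx by (simp add: funpow_swap1)
    ultimately show ?case by blast
  qed simp
  \<comment> \<open>One \<open>w'\<close>-block is \<open>Suc ?q\<close> steps of the
    \<open>w\<close>-walk, the first \<open>?q\<close> of which have the spacers
    \<open>bs\<close>.\<close>
  have one: "parse w' A' x (?n (Suc ?q) i) \<and> (\<forall>t<?q. ?g (?n t i) = bs ! t)
      \<and> ?n (Suc ?q) i \<ge> i + int (length w')" if p: "parse w' A' x i" for i
  proof -
    obtain b where b: "b \<in> A'" "matches x i (block w' b)" "parse w' A' x (i + int (length w' + b))"
      using parse_step[OF assms(2) p] by blast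
    have len: "length (concat (map (block w) (bs @ [b]))) = length w' + b"
      using w'[OF b(1)] by (metis length_block)
    have "matches x i (concat (map (block w) (bs @ [b])))"
      using b w'[OF b(1)] by metis
    moreover have "x (i + int (length (concat (map (block w) (bs @ [b]))))) = 0"
      unfolding len using parse_zero[OF sub'[OF b(3)]] .
    ultimately have "(?n (length (bs @ [b]))) i = i + int (length (concat (map (block w) (bs @ [b]))))
      \<and> (\<forall>t<length (bs @ [b]). ?g (?n t i) = (bs @ [b]) ! t)"
      by (rule walk)
    then have *: "(?n (Suc ?q)) i = i + int (length w' + b)"
       "\<forall>t<Suc ?q. ?g (?n t i) = (bs @ [b]) ! t" unfolding len by auto
    have "\<forall>t<?q. ?g (?n t i) = bs ! t"
      using *(2) by (metis less_SucI nth_append)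
    then show ?thesis using *(1) b(3) by (simp only:) simp
  qed
  have many: "parse w' A' x (?n (k * Suc ?q) i)" if "parse w' A' x i" for k i
  proof (induction k)
    case (Suc k)
    have "?n (Suc k * Suc ?q) i = ?n (Suc ?q) (?n (k * Suc ?q) i)"
      by (simp only: mult_Suc funpow_add o_def)
    then show ?case using one[OF Suc] by simp
  qed (use that in simp)
  have gaps: "?g (?n t i) = bs ! (t mod Suc ?q)" if "parse w' A' x i" "t mod Suc ?q < ?q" for t i
  proof -
    have "?n (t mod Suc ?q + t div Suc ?q * Suc ?q) i = ?n (t mod Suc ?q) (?n ((t div Suc ?q) * Suc ?q) i)"
      by (simp only: funpow_add o_apply)
    then have "?n t i = ?n (t mod Suc ?q) (?n ((t div Suc ?q) * Suc ?q) i)"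
      by (simp only: mod_div_mult_eq)
    then show ?thesis using one[OF many[OF that(1), of "t div Suc ?q"]] that(2) by simp
  qed
  \<comment> \<open>The walk from \<open>i\<close> reaches \<open>j\<close> after \<open>r\<close>
    steps with \<open>0 < r \<le> ?q\<close>, that is, inside the first
    \<open>w'\<close>-block.\<close>
  obtain r where r: "j = ?n r i"
    using parse_reach[OF sep sub'[OF i] sub'[OF j]] ij by auto
  have r0: "r \<noteq> 0" using r ij by (intro notI) simp
  have rq: "r \<le> ?q"
  proof (rule ccontr)
    assume "\<not> r \<le> ?q"
    then obtain d where "r = d + Suc ?q" using le_Suc_ex[of "Suc ?q" r] by (auto simp: add.commute)
    then have "j = ?n d (?n (Suc ?q) i)" using r by (simp only: funpow_add o_def)
    then show False using next_pow_ge[of "?n (Suc ?q) i" d x] one[OF i] ij by linarith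
  qed
  \<comment> \<open>Counted from \<open>j\<close>, a spacer is free only at indices of residue
    \<open>?q\<close>. Counted from \<open>i\<close>, the same index is \<open>t + r\<close>, of
    residue \<open>r - 1 < ?q\<close>, so it is prescribed there.\<close>
  have "?g (?n (t + Suc ?q) j) = ?g (?n t j)" for t
  proof (cases "t mod Suc ?q < ?q")
    case True
    then show ?thesis using gaps[OF j, of t] gaps[OF j, of "t + Suc ?q"] by (simp only: mod_add_self2)
  next
    case False
    then have "t mod Suc ?q = ?q"
      using mod_less_divisor[of "Suc ?q" t, OF zero_less_Suc] by linarith
    then have m: "(t + r) mod Suc ?q = r - 1"
    proof -
      have "t + r = t div Suc ?q * Suc ?q + t mod Suc ?q + r" by (simp only: div_mult_mod_eq)
      also have "\<dots> = (r - 1) + Suc (t div Suc ?q) * Suc ?q"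
        unfolding \<open>t mod Suc ?q = ?q\<close> using r0 by simp
      finally show ?thesis using rq by (simp only: mod_mult_self1) simp
    qed
    have "?g (?n (t + r) i) = bs ! (r - 1)" "?g (?n (t + r + Suc ?q) i) = bs ! (r - 1)"
      using gaps[OF i, of "t + r"] gaps[OF i, of "t + r + Suc ?q"] m r0 rq
      by (simp_all only: mod_add_self2)
    moreover have "?n (t + r) i = ?n t j"
      unfolding r by (simp only: funpow_add o_apply)
    moreover have "t + r + Suc ?q = (t + Suc ?q) + r" by simp
    then have "?n (t + r + Suc ?q) i = ?n (t + Suc ?q) j"
      unfolding r by (simp only: funpow_add[of "t + Suc ?q" r] o_apply)
    ultimately show ?thesis by simp
  qed
  then show ?thesis
    using periodic_gaps[OF sub'[OF j], of "Suc ?q"] by simp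
qed

section \<open>Cuts of points of a Ferenczi subshift\<close>

lemma parsing_gen_word:
  assumes "finite A" shows "parsing (gen_word q s n) A"
proof
  show "gen_word q s n \<noteq> []" by (induction n) auto
  have "\<exists>v. gen_word q s n = 0 # v"
  proof (induction n)
    case (Suc n)
    then show ?case by (cases "q n") (auto simp: upt_conv_Cons simp del: upt_Suc)
  qed simp
  then show "gen_word q s n ! 0 = 0" by auto
qed fact

lemma gen_word_Suc_blocks:
  "gen_word q s (Suc n) = concat (map (block (gen_word q s n)) (map (s n) [0..<q n])) @ gen_word q s n"
  by (simp add: block_def o_def)

text \<open>Brings consecutive generating words into the shape required by
  \<open>parses_refine\<close> and \<open>overlap_periodic\<close>, with the outer spacer as the
  only free one.\<close>

lemma block_gen_word_Suc:
  "block (gen_word q s (Suc n)) b = concat (map (block (gen_word q s n)) (map (s n) [0..<q n] @ [b]))"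
  unfolding block_def[of "gen_word q s (Suc n)"] gen_word_Suc_blocks by (simp add: block_def)

lemma alphabet_Suc_antimono: "m \<le> n \<Longrightarrow> alphabet q s (Suc n) \<subseteq> alphabet q s (Suc m)"
  by (force simp: alphabet_def)

lemma spacer_in_alphabet: "i < q n \<Longrightarrow> m \<le> n \<Longrightarrow> s n i \<in> alphabet q s (Suc m)"
  by (force simp: alphabet_def)

text \<open>Induction on \<open>N\<close>, replacing each \<open>w_N\<close>-block by its
  \<open>w_n\<close>-blocks. \<open>alphabet q s (Suc n)\<close> collects the spacers of all levels
  from \<open>n\<close> on, so it does not change in the induction.\<close>

lemma gen_word_blocks:
  assumes "n \<le> N"
  shows "\<exists>bs. set bs \<subseteq> alphabet q s (Suc n) \<and>
           gen_word q s N = concat (map (block (gen_word q s n)) bs) @ gen_word q s n"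
  using assms
proof (induction N rule: dec_induct)
  case base
  show ?case by (intro exI[of _ "[]"]) simp
next
  case (step N)
  then obtain bs where bs: "set bs \<subseteq> alphabet q s (Suc n)"
    "gen_word q s N = concat (map (block (gen_word q s n)) bs) @ gen_word q s n" by blast
  have block: "block (gen_word q s N) b = concat (map (block (gen_word q s n)) (bs @ [b]))" for b
    by (simp add: block_def[of "gen_word q s N"] bs(2)) (simp add: block_def)
  have "\<exists>ds. set ds \<subseteq> alphabet q s (Suc n) \<and>
      concat (map (block (gen_word q s N)) cs) = concat (map (block (gen_word q s n)) ds)"
    if "set cs \<subseteq> alphabet q s (Suc n)" for cs
    using that
  proof (induction cs)
    case (Cons c cs)
    then obtain ds where "set ds \<subseteq> alphabet q s (Suc n)"
      "concat (map (block (gen_word q s N)) cs) = concat (map (block (gen_word q s n)) ds)" by auto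
    then have "concat (map (block (gen_word q s N)) (c # cs))
        = concat (map (block (gen_word q s n)) (bs @ [c] @ ds))"
      using block[of c] by simp
    then show ?case using Cons.prems bs(1) \<open>set ds \<subseteq> _\<close>
      by (intro exI[of _ "bs @ [c] @ ds"]) (auto simp del: map_append concat_append)
  qed (intro exI[of _ "[]"], simp)
  from this[of "map (s N) [0..<q N]"] obtain ds where ds: "set ds \<subseteq> alphabet q s (Suc n)"
    "concat (map (block (gen_word q s N)) (map (s N) [0..<q N])) = concat (map (block (gen_word q s n)) ds)"
    using spacer_in_alphabet[of _ q N n s] step by (auto simp: image_subset_iff)
  have "gen_word q s (Suc N) = concat (map (block (gen_word q s n)) (ds @ bs)) @ gen_word q s n"
    unfolding gen_word_Suc_blocks ds(2) using bs(2) by simp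
  then show ?case using ds(1) bs(1) by (intro exI[of _ "ds @ bs"]) auto
qed

lemma sublist_gen_word_mono:
  assumes "m \<le> n" shows "sublist (gen_word q s m) (gen_word q s n)"
proof -
  obtain bs where "gen_word q s n = concat (map (block (gen_word q s m)) bs) @ gen_word q s m"
    using gen_word_blocks[OF assms] by blast
  then show ?thesis by simp
qed

text \<open>Each block uses at most \<open>length w + B\<close> symbols, so a visible prefix of
  length \<open>L\<close> contains \<open>t\<close> complete blocks.\<close>

lemma parses_prefix:
  assumes "set bs \<subseteq> A" "\<And>b. b \<in> A \<Longrightarrow> b \<le> B"
    and "matches x i (take L (concat (map (block w) bs) @ w))"
    and "L \<le> length (concat (map (block w) bs) @ w)" "t * (length w + B) < L"
  shows "parses w A x t i"
  using assms
proof (induction t arbitrary: bs i L)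
  case (Suc t)
  obtain b cs where bs: "bs = b # cs"
    using Suc.prems by (cases bs) auto
  have b: "b \<in> A" "b \<le> B" using Suc.prems(1,2) bs by auto
  have L: "length (block w b) + t * (length w + B) < L"
    using Suc.prems(5) b by simp
  have "take L (concat (map (block w) bs) @ w)
      = block w b @ take (L - length (block w b)) (concat (map (block w) cs) @ w)"
    using L bs by simp
  then have m: "matches x i (block w b)"
    "matches x (i + int (length w + b)) (take (L - length (block w b)) (concat (map (block w) cs) @ w))"
    using Suc.prems(3) by (simp_all add: matches_append)
  have "parses w A x t (i + int (length w + b))"
  proof (rule Suc.IH)
    show "matches x (i + int (length w + b)) (take (L - length (block w b)) (concat (map (block w) cs) @ w))"
      by (rule m)
  qed (use Suc.prems bs L in auto)
  then show ?case using b m by auto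
qed simp

text \<open>Consecutive block starts are at most \<open>length w + B\<close> apart, and the text
  from any of them on again has the form of blocks followed by \<open>w\<close>.\<close>

lemma block_start_near:
  assumes "set bs \<subseteq> A" "\<And>b. b \<in> A \<Longrightarrow> b \<le> B" "pos < length (concat (map (block w) bs) @ w)"
  shows "\<exists>p cs. p \<le> pos \<and> pos < p + length w + B \<and> set cs \<subseteq> A \<and>
           drop p (concat (map (block w) bs) @ w) = concat (map (block w) cs) @ w"
  using assms
proof (induction bs arbitrary: pos)
  case Nil
  then show ?case by (intro exI[of _ 0] exI[of _ "[]"]) simp
next
  case (Cons b bs)
  have b: "b \<le> B" using Cons.prems by simp
  show ?case
  proof (cases "pos < length (block w b)")
    case True
    then have "pos < length w + B" using b by (simp only: length_block)
    then show ?thesis using Cons.prems(1)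
      by (intro exI[of _ 0] exI[of _ "b # bs"]) auto
  next
    case False
    then have "pos - length (block w b) < length (concat (map (block w) bs) @ w)"
      using Cons.prems(3) by (simp del: length_block)
    from Cons.IH[OF _ _ this] obtain p cs where "p \<le> pos - length (block w b)" "pos - length (block w b) < p + length w + B"
       "set cs \<subseteq> A" "drop p (concat (map (block w) bs) @ w) = concat (map (block w) cs) @ w"
      using Cons.prems(1,2) by auto
    then show ?thesis using False
      by (intro exI[of _ "length (block w b) + p"] exI[of _ cs]) auto
  qed
qed

lemma matches_map_upto: "matches x i (map x [i..j])"
  unfolding matches_def by (auto simp: nth_upto)

text \<open>The two-sided repetition of one period of \<open>x\<close> has only factors that occur
  in \<open>x\<close> to the right of \<open>j\<close>, so it stays in the subshift.\<close>

lemma eventually_periodic_in_subshift: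
  assumes x: "x \<in> subshift_of A L" and P: "P > (0::int)" and per: "\<And>m. m \<ge> j \<Longrightarrow> x (m + P) = x m"
  shows "\<exists>z\<in>subshift_of A L. (shift_map ^^ nat P) z = z"
proof -
  define z where "z m = x (j + m mod P)" for m
  have per': "x (j + u + int k * P) = x (j + u)" if "u \<ge> 0" for u k
  proof (induction k)
    case (Suc k)
    have "x (j + u + int (Suc k) * P) = x (j + u + int k * P + P)" by (simp add: algebra_simps)
    also have "\<dots> = x (j + u + int k * P)" using that P by (intro per) simp
    finally show ?case using Suc by simp
  qed simp
  have red: "x (j + u) = x (j + u mod P)" if "u \<ge> 0" for u
  proof -
    have "u = u mod P + int (nat (u div P)) * P"
      using that P by (simp add: pos_imp_zdiv_nonneg_iff)
    then have "x (j + u) = x (j + u mod P + int (nat (u div P)) * P)" by (simp add: add.assoc)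
    also have "\<dots> = x (j + u mod P)" using P by (intro per') simp
    finally show ?thesis .
  qed
  have "z \<in> subshift_of A L"
    unfolding subshift_of_def
  proof (safe)
    show "z m \<in> A" for m using x by (auto simp: subshift_of_def z_def)
    fix a b
    \<comment> \<open>A multiple of the period large enough to move the window to nonnegative
      offsets, where \<open>z\<close> and \<open>x\<close> can be compared.\<close>
    define t where "t = \<bar>a\<bar> * P"
    have ta: "a + t \<ge> 0" using P mult_left_mono[of 1 P "\<bar>a\<bar>"] by (simp add: t_def)
    have tm: "t mod P = 0" by (simp add: t_def)
    have "z m = x (j + t + m)" if "m \<ge> a" for m
    proof -
      have "(m + t) mod P = m mod P" by (simp add: t_def)
      then show ?thesis using red[of "m + t"] ta that by (simp add: z_def add_ac)
    qed
    then have "map z [a..b] = map (\<lambda>m. x (j + t + m)) [a..b]" by auto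
    also have "\<dots> = map x [j + t + a..j + t + b]"
      by (rule nth_equalityI) (auto simp: nth_upto add.assoc)
    finally show "\<exists>w\<in>L. sublist (map z [a..b]) w" using x by (auto simp: subshift_of_def)
  qed
  moreover have "(shift_map ^^ nat P) z = z"
    using P by (auto simp: fun_eq_iff shift_map_funpow z_def)
  ultimately show ?thesis by blast
qed

section \<open>Separation and bounded spacing of cuts\<close>

locale ferenczi =
  fixes q :: "nat \<Rightarrow> nat" and s :: "nat \<Rightarrow> nat \<Rightarrow> nat" and B :: nat
  assumes std: "standard q" and bound: "\<And>n i. i < q n \<Longrightarrow> s n i \<le> B"
    and aper: "aperiodic (ferenczi_subshift q s)"
begin

abbreviation "X \<equiv> ferenczi_subshift q s"
abbreviation "W \<equiv> gen_word q s"
abbreviation "Al n \<equiv> alphabet q s (Suc n)"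

definition H :: "nat \<Rightarrow> nat" where "H n = length (W n)"

definition cut :: "nat \<Rightarrow> (int \<Rightarrow> nat) \<Rightarrow> int \<Rightarrow> bool" where
  "cut n x i \<longleftrightarrow> parse (W n) (Al n) x i"

lemma Al_le: "b \<in> Al n \<Longrightarrow> b \<le> B"
  using bound by (auto simp: alphabet_def)

lemma finite_Al: "finite (Al n)"
  by (rule finite_subset[of _ "{..B}"]) (auto dest: Al_le)

sublocale parsing "W n" "Al n" for n
  by (rule parsing_gen_word[OF finite_Al])

lemma H_Suc: "H (Suc n) \<ge> 2 * H n"
proof -
  obtain k where "q n = Suc k" using std by (metis standard_def not_numeral_le_zero not0_implies_Suc)
  then show ?thesis unfolding H_def gen_word_Suc_blocks by (simp add: upt_conv_Cons del: upt_Suc)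
qed

lemma H_ge: "H n \<ge> Suc n"
proof (induction n)
  case (Suc n)
  then show ?case using H_Suc[of n] by linarith
qed (simp add: H_def)

lemma no_eventual_period:
  assumes "x \<in> X" "P > 0" "\<And>m. m \<ge> j \<Longrightarrow> x (m + P) = x m"
  shows False
proof -
  have "\<exists>z\<in>X. (shift_map ^^ nat P) z = z"
    using eventually_periodic_in_subshift[of x _ _ P j] assms by (auto simp: ferenczi_subshift_def)
  moreover have "nat P \<ge> 1" using assms by simp
  ultimately show False using aper by (auto simp: aperiodic_def)
qed

text \<open>Induction on the level. At level 0 the claim is trivial since \<open>H 0 = 1\<close>; in
  the step, cuts that are too close overlap, and \<open>overlap_periodic\<close> produces a
  periodicity that aperiodicity excludes.\<close>

lemma cut_separated:
  assumes "x \<in> X" "cut n x i" "cut n x j" "i < j"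
  shows "i + int (H n) \<le> j"
  using assms(2-)
proof (induction n arbitrary: i j)
  case 0
  then show ?case by (simp add: H_def)
next
  case (Suc n)
  show ?case
  proof (rule ccontr)
    assume "\<not> ?thesis"
    then have "\<exists>P>0. \<forall>m\<ge>j. x (m + P) = x m"
      using Suc.prems Suc.IH alphabet_Suc_antimono[of n "Suc n" q s]
      by (intro overlap_periodic[OF parsing_axioms[of n] finite_Al block_gen_word_Suc])
        (auto simp: cut_def H_def intro: spacer_in_alphabet)
    then show False using no_eventual_period[OF assms(1)] by blast
  qed
qed

text \<open>A long window around the origin occurs in a generating word, whose
  \<open>w_n\<close>-blocks start within \<open>H n + B\<close> of any position. Each depth
  \<open>t\<close> thus gives a start close to the left of 0, and \<open>uniform_choice\<close>
  finds one that serves all depths.\<close>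

lemma cut_near:
  assumes "x \<in> X"
  shows "\<exists>k<H n + B. cut n x (- int k)"
proof -
  define K where "K = H n + B"
  have "\<exists>k\<in>{..<K}. parses (W n) (Al n) x t (- int k)" for t
  proof -
    define M where "M = t * K"
    let ?u = "map x [-int K..int M]"
    obtain N where "sublist ?u (W N)"
      using assms by (fastforce simp: ferenczi_subshift_def subshift_of_def)
    \<comment> \<open>Raising the level to at least \<open>n\<close> makes the decomposition into
      \<open>w_n\<close>-blocks available.\<close>
    then have "sublist ?u (W (max n N))"
      using sublist_gen_word_mono[of N "max n N" q s] sublist_order.order.trans by fastforce
    then obtain pre suf where split: "W (max n N) = pre @ ?u @ suf"
      by (auto simp: sublist_def)
    obtain bs where bs: "set bs \<subseteq> Al n" "W (max n N) = concat (map (block (W n)) bs) @ W n"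
      using gen_word_blocks[of n "max n N" q s] by auto
    have len: "length ?u = K + M + 1" by (simp add: nat_eq_iff)
    let ?pos = "length pre + K"
    have "?pos < length (concat (map (block (W n)) bs) @ W n)"
      unfolding bs(2)[symmetric] split using len by simp
    from block_start_near[OF bs(1) Al_le[of _ n] this] obtain p cs where
      p: "p \<le> ?pos" "?pos < p + length (W n) + B" "set cs \<subseteq> Al n"
      "drop p (W (max n N)) = concat (map (block (W n)) cs) @ W n"
      unfolding bs(2) by blast
    define k where "k = ?pos - p"
    have k: "k < K" using p by (simp add: k_def H_def K_def)
    define d where "d = p - length pre"
    have d: "p = length pre + d" "d + k = K" using p by (auto simp: k_def d_def H_def K_def)
    have L: "k + M + 1 = length (drop d ?u)" using d(2) len by simp
    have "take (k + M + 1) (drop p (W (max n N))) = drop d ?u"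
      unfolding split d(1) using L d(2) len by simp
    moreover have "matches x (- int k) (drop d ?u)"
    proof -
      have "matches x (- int K) (take d ?u @ drop d ?u)"
        unfolding append_take_drop_id by (rule matches_map_upto)
      then have "matches x (- int K + int (length (take d ?u))) (drop d ?u)"
        unfolding matches_append by blast
      moreover have "- int K + int (length (take d ?u)) = - int k"
        using d(2) len by simp
      ultimately show ?thesis by (simp only:)
    qed
    ultimately have m: "matches x (- int k) (take (k + M + 1) (concat (map (block (W n)) cs) @ W n))"
      using p(4) by simp
    have "length (drop p (W (max n N))) \<ge> k + M + 1"
      unfolding split d(1) using L by simp
    then have "parses (W n) (Al n) x t (- int k)"
      using p(3,4) m by (intro parses_prefix[OF _ Al_le m]) (auto simp: H_def K_def M_def)
    then show ?thesis using k by blast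
  qed
  then have "\<exists>k\<in>{..<K}. \<forall>t. parses (W n) (Al n) x t (- int k)"
    by (intro uniform_choice) (auto intro: parses_antimono)
  then show ?thesis by (auto simp: cut_def parse_def K_def)
qed

lemma cut_next:
  assumes "cut n x i"
  obtains b where "b \<in> Al n" "matches x i (block (W n) b)" "cut n x (i + int (H n + b))"
  using parse_step[OF finite_Al assms[unfolded cut_def]] by (auto simp: cut_def H_def)

lemma cut_reach:
  assumes "x \<in> X" "cut n x i" "cut n x j" "i \<le> j"
  shows "\<exists>r. j = (next_pos (W n) x ^^ r) i"
  using assms cut_separated[of x n] by (intro parse_reach) (auto simp: cut_def H_def)

lemma cut_shift: "cut n ((shift_map ^^ k) x) i \<longleftrightarrow> cut n x (i + int k)"
  by (simp add: cut_def parse_funpow_shift)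

text \<open>With a single spacer the gaps to the right of a cut would be constant, hence the point
  eventually periodic.\<close>

lemma two_spacers: "\<exists>a\<in>Al n. \<exists>b\<in>Al n. a \<noteq> b"
proof (rule ccontr)
  assume *: "\<not> ?thesis"
  obtain x where x: "x \<in> X" using aper by (auto simp: aperiodic_def)
  obtain k where k: "parse (W n) (Al n) x (- int k)" using cut_near[OF x] by (auto simp: cut_def)
  have "gap x ((next_pos (W n) x ^^ (t + 1)) (- int k) + int (length (W n))) =
                gap x ((next_pos (W n) x ^^ t) (- int k) + int (length (W n)))" for t
    using * parse_next(1)[OF parse_next_pow[OF k]] by blast
  from periodic_gaps[OF k _ this] show False using no_eventual_period[OF x] by blast
qed

text \<open>A decreasing sequence of finite sets is constant from an index of minimal cardinality
  on, so the \<open>LEAST\<close> in \<open>stab_level\<close> is attained.\<close>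

lemma alphabet_eventually:
  "stab_level q s \<ge> 1" "\<And>m. m \<ge> stab_level q s \<Longrightarrow> alphabet q s m = eventual_alphabet q s"
proof -
  obtain n where n: "\<And>m. card (Al n) \<le> card (Al m)"
    using ex_has_least_nat[of "\<lambda>_. True" 0 "\<lambda>n. card (Al n)"] by auto
  have "Al m = Al n" if "m \<ge> n" for m
    using card_subset_eq[OF finite_Al alphabet_Suc_antimono[OF that]] n[of m]
      card_mono[OF finite_Al alphabet_Suc_antimono[OF that]] by (simp add: le_antisym)
  then have "\<forall>m\<ge>Suc n. alphabet q s m = alphabet q s (Suc n)"
    by (metis Suc_le_D Suc_le_mono)
  then have "Suc n \<ge> 1 \<and> (\<forall>m\<ge>Suc n. alphabet q s m = alphabet q s (Suc n))"
    by (intro conjI) (simp, assumption)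
  then have "stab_level q s \<ge> 1 \<and>
      (\<forall>m\<ge>stab_level q s. alphabet q s m = alphabet q s (stab_level q s))"
    unfolding stab_level_def
    by (rule LeastI[of "\<lambda>n. n \<ge> 1 \<and> (\<forall>m\<ge>n. alphabet q s m = alphabet q s n)"])
  then show "stab_level q s \<ge> 1" "\<And>m. m \<ge> stab_level q s \<Longrightarrow> alphabet q s m = eventual_alphabet q s"
    unfolding eventual_alphabet_def by blast+
qed

end

section \<open>Towers and continuous eigenvalues\<close>

lemma apply_word_append: "apply_word f (u @ v) = apply_word f u @ apply_word f v"
  by (simp add: apply_word_def)

lemma apply_word_comp: "apply_word f (apply_word g u) = apply_word (\<lambda>a. apply_word f (g a)) u"
  by (induction u) (simp_all add: apply_word_def)

lemma foldr_apply_word: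
  "foldr (\<lambda>k. apply_word (f k)) ks u = apply_word (\<lambda>a. foldr (\<lambda>k. apply_word (f k)) ks [a]) u"
proof (induction ks)
  case Nil
  then show ?case by (simp add: apply_word_def)
next
  case (Cons k ks)
  then show ?case by (simp add: apply_word_comp[symmetric] flip: Cons)
qed

lemma tau_range_Suc: "tau_range q s 0 (Suc N) a = apply_word (tau_range q s 0 N) (tau q s N a)"
  using foldr_apply_word[of "tau q s" "[0..<N]" "tau q s N a"]
  by (simp add: tau_range_def[abs_def] apply_word_def[of "tau q s N"])

lemma length_apply_word_ge:
  assumes "\<And>a. f a \<noteq> []"
  shows "length (apply_word f u) \<ge> length u"
proof (induction u)
  case (Cons a u)
  have "length (apply_word f (a # u)) = length (f a) + length (apply_word f u)"
    by (simp add: apply_word_def)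
  moreover have "length (f a) \<noteq> 0" using assms by simp
  ultimately show ?case using Cons by (simp only: list.size)
qed (simp add: apply_word_def)

lemma map_upto_nat: "map y [0..int M] = map (\<lambda>t. y (int t)) [0..<Suc M]"
  by (rule nth_equalityI) (auto simp: nth_upto simp del: upt_Suc)

text \<open>\<open>apply_biinf\<close> reads position \<open>i\<close> from the image of
  \<open>Suc i\<close> letters; any other prefix whose image reaches \<open>i\<close> gives the same
  symbol.\<close>

lemma apply_word_prefix_nth:
  assumes "\<And>a. f a \<noteq> []" "i < length (apply_word f (map y [0..<M]))"
  shows "apply_word f (map y [0..<Suc i]) ! i = apply_word f (map y [0..<M]) ! i"
proof -
  have "length (map y [0..<Suc i]) \<le> length (apply_word f (map y [0..<Suc i]))"
    by (rule length_apply_word_ge) (rule assms(1))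
  then have len: "i < length (apply_word f (map y [0..<Suc i]))"
    by (simp only: length_map length_upt)
  have ext: "apply_word f (map y [0..<b]) ! i = apply_word f (map y [0..<a]) ! i"
    if "a \<le> b" "i < length (apply_word f (map y [0..<a]))" for a b
  proof -
    obtain d where "b = a + d" using \<open>a \<le> b\<close> le_Suc_ex by blast
    then have "apply_word f (map y [0..<b]) = apply_word f (map y [0..<a]) @ apply_word f (map y [a..<b])"
      by (simp only: upt_add_eq_append[of 0 a d, OF le0] map_append apply_word_append)
    then show ?thesis using that(2) by (simp only: nth_append if_True)
  qed
  show ?thesis
  proof (cases "Suc i \<le> M")
    case True
    then show ?thesis using ext[OF True len] by simp
  next
    case False
    then have "M \<le> Suc i" by simp
    then show ?thesis using ext[OF _ assms(2)] by blast
  qed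
qed

text \<open>The level morphisms are conjugate to \<open>a \<mapsto> w\<^sub>n 1\<^sup>a\<close>, by a word that does not depend on \<open>a\<close>;
  so towers are unions of translates of the event that \<open>w\<^sub>n\<close> is followed by the spacer \<open>a\<close>.\<close>

lemma tau_range_conjugate:
  "\<exists>p. \<forall>v. p @ apply_word (tau_range q s 0 (Suc n)) v = concat (map (block (gen_word q s n)) v) @ p"
  if "\<And>n. q n \<ge> 1"
proof (induction n)
  case 0
  have "tau_range q s 0 (Suc 0) = block [0]"
    by (rule ext) (simp add: tau_range_def apply_word_def tau_def block_def)
  then show ?case by (intro exI[of _ "[]"]) (simp add: apply_word_def)
next
  case (Suc n)
  let ?w = "gen_word q s n"
  from Suc obtain p where p: "\<And>v. p @ apply_word (tau_range q s 0 (Suc n)) v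
    = concat (map (block ?w) v) @ p" by blast
  \<comment> \<open>\<open>tau\<close> moves the first spacer of level \<open>n\<close> to the end
    of the word; prepending its block to \<open>p\<close> undoes this rotation.\<close>
  define p' where "p' = block ?w (s n 0) @ p"
  have q: "map (s n) [0..<q n] = s n 0 # map (s n) [1..<q n]"
    using that[of n] by (simp add: upt_conv_Cons)
  have step: "p' @ tau_range q s 0 (Suc (Suc n)) a = block (gen_word q s (Suc n)) a @ p'" for a
    unfolding tau_range_Suc[of q s "Suc n"] p'_def block_gen_word_Suc q append_assoc p
    by (simp add: tau_def)
  have "p' @ apply_word (tau_range q s 0 (Suc (Suc n))) v
      = concat (map (block (gen_word q s (Suc n))) v) @ p'" for v
  proof (induction v)
    case (Cons a v)
    have "p' @ apply_word (tau_range q s 0 (Suc (Suc n))) (a # v)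
        = (p' @ tau_range q s 0 (Suc (Suc n)) a) @ apply_word (tau_range q s 0 (Suc (Suc n))) v"
      by (simp add: apply_word_def)
    also have "\<dots> = block (gen_word q s (Suc n)) a @ p' @ apply_word (tau_range q s 0 (Suc (Suc n))) v"
      unfolding step by simp
    finally show ?case using Cons by simp
  qed (simp add: apply_word_def)
  then show ?case by blast
qed

context ferenczi
begin

text \<open>In the image \<open>z\<close> of \<open>y\<close>, the conjugating word \<open>p\<close>
  ends just before the origin. Blocks therefore start at \<open>- length p\<close>, the first with
  spacer \<open>y 0 = a\<close>; shifting by \<open>k\<close> moves both of its ends.\<close>

lemma tower_cover:
  obtains p where
    "\<And>a. tower q s (Suc n) a \<subseteq>
      (\<Union>k<H n + a. {x. cut n x (- int (p + k)) \<and> cut n x (- int (p + k) + int (H n + a))})"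
proof -
  have q: "q n \<ge> 1" for n using std[unfolded standard_def, rule_format, of n] by simp
  define \<sigma> where "\<sigma> = tau_range q s 0 (Suc n)"
  obtain p where p: "\<And>v. p @ apply_word \<sigma> v = concat (map (block (W n)) v) @ p"
    using tau_range_conjugate[of q s n] q unfolding \<sigma>_def by blast
  have len: "length (\<sigma> a) = H n + a" for a
    using arg_cong[OF p[of "[a]"], of length] by (simp add: apply_word_def H_def)
  have ne: "\<sigma> a \<noteq> []" for a using len[of a] H_ge[of n] by auto
  have "tower q s (Suc n) a \<subseteq>
      (\<Union>k<H n + a. {x. cut n x (- int (length p + k)) \<and> cut n x (- int (length p + k) + int (H n + a))})" for a
  proof
    fix x assume "x \<in> tower q s (Suc n) a"
    then have "x \<in> (\<Union>k<length (\<sigma> a). (shift_map ^^ k) ` apply_biinf \<sigma> `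
        {y \<in> level_subshift q s (Suc n). y 0 = a})"
      by (simp only: tower_def \<sigma>_def)
    then obtain k y where k: "k < H n + a" and y: "y \<in> level_subshift q s (Suc n)" "y 0 = a"
      and x: "x = (shift_map ^^ k) (apply_biinf \<sigma> y)"
      unfolding len by blast
    define z where "z = apply_biinf \<sigma> y"
    define v where "v M = map (\<lambda>t. y (int t)) [0..<M]" for M
    have ran: "y t \<in> Al n" for t using y by (auto simp: level_subshift_def subshift_of_def)
    have z: "matches z (- int (length p)) (p @ apply_word \<sigma> (v M))" for M
      unfolding matches_def
    proof (intro allI impI)
      fix i assume i: "i < length (p @ apply_word \<sigma> (v M))"
      show "z (- int (length p) + int i) = (p @ apply_word \<sigma> (v M)) ! i"
      proof (cases "i < length p")
        \<comment> \<open>Left of the origin \<open>z\<close> is read from the image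
          \<open>u\<close> of the last \<open>r\<close> letters. Since \<open>p @ u = C @ p\<close>,
          the words \<open>u\<close> and \<open>p\<close> agree in their last \<open>r\<close>
          symbols.\<close>
        case True
        define r where "r = length p - i"
        define u where "u = apply_word \<sigma> (map y [- int r..-1])"
        have ru: "r \<le> length u"
          using length_apply_word_ge[of \<sigma> "map y [- int r..-1]", OF ne] by (simp add: u_def)
        have r: "0 < r" "r \<le> length p" "i = length p - r" using True by (auto simp: r_def)
        obtain C where C: "p @ u = C @ p" using p unfolding u_def by blast
        have "length p + length u = length C + length p"
          using arg_cong[OF C, of length] by (simp only: length_append)
        then have "length u = length C" by simp
        then have "(p @ u) ! (length u + i) = p ! i"
          unfolding C by (simp only: nth_append_length_plus)
        moreover have "length u + i = length p + (length u - r)" using r ru by simp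
        then have "(p @ u) ! (length u + i) = u ! (length u - r)"
          by (simp only: nth_append_length_plus)
        moreover have "- int (length p) + int i = - int r" using r by simp
        then have "z (- int (length p) + int i) = u ! (length u - r)"
          unfolding z_def apply_biinf_def u_def Let_def using r(1) by simp
        ultimately show ?thesis using True by (simp add: nth_append)
      next
        case False
        define m where "m = i - length p"
        have m: "- int (length p) + int i = int m" using False by (simp add: m_def)
        have "z (int m) = apply_word \<sigma> (map (\<lambda>t. y (int t)) [0..<Suc m]) ! m"
          unfolding z_def apply_biinf_def map_upto_nat by simp
        also have "\<dots> = apply_word \<sigma> (v M) ! m"
          unfolding v_def using i False by (intro apply_word_prefix_nth ne) (auto simp: m_def v_def)
        finally show ?thesis unfolding m using False by (simp add: nth_append m_def)
      qed
    qed
    have zm: "matches z (- int (length p)) (concat (map (block (W n)) (v M)))" for M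
      using z[of M] unfolding p matches_append by blast
    define e where "e M = - int (length p) + int (length (concat (map (block (W n)) (v M))))" for M
    have vS: "v (Suc M) = v M @ [y (int M)]" for M by (simp add: v_def)
    have eS: "e (Suc M) = e M + int (length (W n) + y (int M))" for M
      by (simp add: e_def vS)
    \<comment> \<open>The ends \<open>e T\<close> of the first \<open>T\<close> blocks form a set
      closed under reading a block.\<close>
    have "parse (W n) (Al n) z (e T)" for T
    proof (rule parse_coinduct[where R = "\<lambda>i. \<exists>T. i = e T"])
      fix i assume "\<exists>T. i = e T"
      then obtain T where "i = e T" by blast
      moreover have "matches z (e T) (block (W n) (y (int T)))"
        using zm[of "Suc T"] by (simp add: vS matches_append e_def)
      ultimately show "\<exists>b\<in>Al n. matches z i (block (W n) b) \<and> (\<exists>T. i + int (length (W n) + b) = e T)"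
        using ran eS[of T] by (intro bexI[of _ "y (int T)"] conjI exI[of _ "Suc T"]) simp_all
    qed blast
    then have "cut n z (e T)" for T by (simp add: cut_def)
    from this[of 0] this[of "Suc 0"] have
      "cut n x (- int (length p + k))" "cut n x (- int (length p + k) + int (H n + a))"
      unfolding x z_def[symmetric] cut_shift eS by (simp_all add: e_def v_def H_def y)
    then show "x \<in> (\<Union>k<H n + a. {x. cut n x (- int (length p + k)) \<and> cut n x (- int (length p + k) + int (H n + a))})"
      using k by blast
  qed
  then show ?thesis by (rule that)
qed

end

section \<open>Topology of cuts and the continuous eigenfunction\<close>

lemma clopen_coordinate: "open {x :: int \<Rightarrow> nat. x i = c}" "closed {x :: int \<Rightarrow> nat. x i = c}"
proof -
  have *: "open ((\<lambda>x :: int \<Rightarrow> nat. x i) -` A)" for A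
    by (rule open_vimage[OF Topological_Spaces.open_discrete]) (rule continuous_on_product_coordinates)
  show "open {x :: int \<Rightarrow> nat. x i = c}" using *[of "{c}"] by (simp add: vimage_def)
  show "closed {x :: int \<Rightarrow> nat. x i = c}"
   using *[of "-{c}"]  by (simp add: vimage_def closed_def Collect_neg_eq)
qed

lemma open_window: "open {x :: int \<Rightarrow> nat. P (map x is)}"
proof -
  have single: "open {x :: int \<Rightarrow> nat. map x is = l}" for l
  proof (induction "is" arbitrary: l)
    case (Cons i "is")
    show ?case
    proof (cases l)
      case (Cons c l')
      have "{x. map x (i # is) = l} = {x. x i = c} \<inter> {x. map x is = l'}" using Cons by auto
      then show ?thesis using Cons.IH[of l'] clopen_coordinate(1) by (simp add: open_Int)
    qed simp
  qed (cases l, simp_all)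
  have "{x. P (map x is)} = (\<Union>l\<in>{l. P l}. {x. map x is = l})" by auto
  then show ?thesis using single by auto
qed

lemma closed_window: "closed {x :: int \<Rightarrow> nat. P (map x is)}"
  using open_window[of "\<lambda>l. \<not> P l"] by (simp add: closed_def Collect_neg_eq)

lemma closed_subshift_of: "closed (subshift_of A L)"
proof -
  have eq: "subshift_of A L = (\<Inter>i. {x. set (map x [i]) \<subseteq> A}) \<inter>
      (\<Inter>i j. {x. \<exists>w\<in>L. sublist (map x [i..j]) w})"
    by (auto simp: subshift_of_def)
  have "closed {x :: int \<Rightarrow> nat. set (map x [i]) \<subseteq> A}" for i
    by (rule closed_window[of "\<lambda>l. set l \<subseteq> A"])
  moreover have "closed {x. \<exists>w\<in>L. sublist (map x [i..j]) w}" for i j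
    by (rule closed_window[of "\<lambda>l. \<exists>w\<in>L. sublist l w"])
  ultimately show ?thesis unfolding eq by (intro closed_Int closed_INT ballI)
qed

lemma closed_matches: "closed {x. matches x i w}"
proof -
  have eq: "{x. matches x i w} = (\<Inter>k\<in>{..<length w}. {x. x (i + int k) = w ! k})"
    by (auto simp: matches_def)
  show ?thesis unfolding eq by (intro closed_INT ballI clopen_coordinate(2))
qed

lemma closed_parses: "finite A \<Longrightarrow> closed {x. parses w A x t i}"
proof (induction t arbitrary: i)
  case (Suc t)
  have eq: "{x. parses w A x (Suc t) i} =
    (\<Union>b\<in>A. {x. matches x i (block w b)} \<inter> {x. parses w A x t (i + int (length w + b))})" by auto
  show ?case unfolding eq using Suc by (intro closed_UN ballI closed_Int closed_matches)
qed simp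

lemma (in ferenczi) closed_cut: "closed {x. cut n x i}"
proof -
  have eq: "{x. cut n x i} = (\<Inter>t. {x. parses (W n) (Al n) x t i})"
    by (auto simp: cut_def parse_def)
  show ?thesis unfolding eq by (intro closed_INT ballI closed_parses finite_Al)
qed

text \<open>Points of \<open>K\<close> agreeing with \<open>x\<close> on growing windows converge to
  \<open>x\<close> in every coordinate, hence in the product topology.\<close>

lemma closed_agreeing_windows:
  fixes K :: "(int \<Rightarrow> nat) set"
  assumes "closed K" "\<And>M. \<exists>y\<in>K. map x [- int M..int M] = map y [- int M..int M]"
  shows "x \<in> K"
proof -
  obtain y where y: "\<And>M. y M \<in> K" "\<And>M. map x [- int M..int M] = map (y M) [- int M..int M]"
    using assms(2) by metis
  have "(\<lambda>M. y M i) \<longlonglongrightarrow> x i" for i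
  proof (rule tendsto_eventually)
    show "\<forall>\<^sub>F M in sequentially. y M i = x i"
      using eventually_ge_at_top[of "nat \<bar>i\<bar>"]
    proof eventually_elim
      case (elim M)
      then have "i \<in> set [- int M..int M]" by auto
      then show ?case using y(2)[of M] by (metis map_eq_conv)
    qed
  qed
  then have "limitin (product_topology (\<lambda>_. euclidean) UNIV) y x sequentially"
    by (simp add: limitin_componentwise)
  then have "y \<longlonglongrightarrow> x" by (simp add: euclidean_product_topology)
  then show ?thesis using closed_sequentially[OF assms(1)] y(1) by blast
qed

lemma shift_map_in_subshift:
  assumes "x \<in> subshift_of A L"
  shows "shift_map x \<in> subshift_of A L"
proof -
  have *: "x i \<in> A" "\<exists>w\<in>L. sublist (map x [i..j]) w" for i j
    using assms by (auto simp: subshift_of_def)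
  have "map (shift_map x) [i..j] = map x [i + 1..j + 1]" for i j
    by (rule nth_equalityI) (auto simp: nth_upto shift_map_def algebra_simps)
  then show ?thesis unfolding subshift_of_def using * by (auto simp only: shift_map_def)
qed

text \<open>The eigenfunction is \<open>l\<close> to the power of the distance from the origin back
  to a cut. The choice of the cut does not matter, as distances between cuts are sums of terms
  \<open>H n + b\<close>.\<close>

lemma (in ferenczi) continuous_eigenvalue_of_blocks:
  assumes "\<And>b. b \<in> Al n \<Longrightarrow> l ^ (H n + b) = 1"
  shows "continuous_eigenvalue X l"
proof -
  have step: "l ^ nat ((next_pos (W n) x ^^ r) i - i) = 1" if "cut n x i" for x i r
  proof (induction r)
    case (Suc r)
    let ?e = "(next_pos (W n) x ^^ r) i"
    have p: "parse (W n) (Al n) x ?e" using that parse_next_pow by (simp add: cut_def)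
    obtain b where b: "b \<in> Al n" "next_pos (W n) x ?e = ?e + int (H n + b)"
      using parse_next(1)[OF p] by (auto simp: next_pos_def H_def)
    have "?e \<ge> i" using next_pow_ge[of i r n x] by simp
    then have "nat ((next_pos (W n) x ^^ Suc r) i - i) = nat (?e - i) + (H n + b)"
      using b(2) by simp
    then show ?case using Suc assms[OF b(1)] by (simp add: power_add)
  qed simp
  have eq: "l ^ k = l ^ k'" if x: "x \<in> X" and c: "cut n x (- int k)" "cut n x (- int k')" and "k \<le> k'" for x k k'
  proof -
    obtain r where r: "- int k = (next_pos (W n) x ^^ r) (- int k')"
      using cut_reach[OF x c(2,1)] \<open>k \<le> k'\<close> by auto
    have "nat ((next_pos (W n) x ^^ r) (- int k') - - int k') = k' - k"
      unfolding r[symmetric] using \<open>k \<le> k'\<close> by simp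
    then have "l ^ (k' - k) = 1" using step[OF c(2), of r] by (simp only:)
    then show ?thesis using \<open>k \<le> k'\<close> power_add[of l k "k' - k"] by simp
  qed
  define f where "f x = l ^ (SOME k. cut n x (- int k))" for x
  have f: "f x = l ^ k" if "x \<in> X" "cut n x (- int k)" for x k
  proof -
    have "cut n x (- int (SOME k. cut n x (- int k)))" using that(2) by (rule someI)
    then show ?thesis using eq[OF that(1) that(2)] eq[OF that(1) _ that(2)]
      unfolding f_def by (cases "k \<le> (SOME k. cut n x (- int k))") (simp, metis nat_le_linear)
  qed
  have l: "l \<noteq> 0"
  proof -
    obtain b where "b \<in> Al n" using two_spacers[of n] by auto
    then have "l ^ (H n + b) = 1" by (rule assms)
    moreover have "H n + b \<noteq> 0" using H_ge[of n] by simp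
    ultimately show ?thesis by (cases "l = 0") (simp_all add: power_0_left split: if_splits)
  qed
  \<comment> \<open>By \<open>cut_near\<close> finitely many closed pieces cover \<open>X\<close>,
    and on each of them \<open>f\<close> is constant.\<close>
  have "continuous_on (\<Union>k\<in>{..<H n + B}. X \<inter> {x. cut n x (- int k)}) f"
  proof (rule continuous_on_closed_Union)
    show "closed (X \<inter> {x. cut n x (- int k)})" for k
      unfolding ferenczi_subshift_def by (intro closed_Int closed_subshift_of closed_cut)
    have "continuous_on (X \<inter> {x. cut n x (- int k)}) f
        \<longleftrightarrow> continuous_on (X \<inter> {x. cut n x (- int k)}) (\<lambda>_. l ^ k)" for k
      by (intro continuous_on_cong refl f) simp_all
    then show "continuous_on (X \<inter> {x. cut n x (- int k)}) f" for k
      by simp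
  qed simp
  moreover have "(\<Union>k\<in>{..<H n + B}. X \<inter> {x. cut n x (- int k)}) = X"
    using cut_near[of _ n] by auto
  ultimately have "continuous_on X f" by simp
  moreover obtain x where "x \<in> X" using aper by (auto simp: aperiodic_def)
  then have "\<exists>x\<in>X. f x \<noteq> 0" using l by (auto simp: f_def)
  moreover have "f (shift_map x) = l * f x" if x: "x \<in> X" for x
  proof -
    obtain k where k: "cut n x (- int k)" using cut_near[OF x, of n] by blast
    have "shift_map x \<in> X"
      using x unfolding ferenczi_subshift_def by (rule shift_map_in_subshift)
    then have "f (shift_map x) = l ^ Suc k"
    proof (rule f)
      show "cut n (shift_map x) (- int (Suc k))"
        using k cut_shift[of n 1 x "- int (Suc k)"] by simp
    qed
    then show ?thesis using f[OF x k] by simp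
  qed
  ultimately show ?thesis by (auto simp: continuous_eigenvalue_def)
qed

section \<open>Measurable eigenvalues\<close>

locale ferenczi_measure = ferenczi +
  fixes \<mu> :: "(int \<Rightarrow> nat) measure"
  assumes inv: "invariant_prob (ferenczi_subshift q s) \<mu>"
begin

sublocale prob_space \<mu>
  using inv by (simp add: invariant_prob_def)

lemma sets_\<mu>: "sets \<mu> = sets (restrict_space borel X)"
  using inv by (simp add: invariant_prob_def)

lemma space_\<mu>: "space \<mu> = X"
  using sets_eq_imp_space_eq[OF sets_\<mu>] by (simp add: space_restrict_space)

lemma shift_measurable: "shift_map \<in> measurable \<mu> \<mu>"
  using inv by (simp add: invariant_prob_def)

lemma distr_shift: "distr \<mu> \<mu> shift_map = \<mu>"
  using inv by (simp add: invariant_prob_def)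

lemma closed_in_sets: "closed C \<Longrightarrow> {x \<in> X. x \<in> C} \<in> sets \<mu>"
  unfolding sets_\<mu> sets_restrict_space by (auto simp: Int_def intro!: image_eqI[of _ _ C])

lemma shift_in: "x \<in> X \<Longrightarrow> shift_map x \<in> X"
  using measurable_space[OF shift_measurable] by (simp add: space_\<mu>)

lemma shift_pow_in: "x \<in> X \<Longrightarrow> (shift_map ^^ k) x \<in> X"
  by (induction k) (auto intro: shift_in)

lemma measure_shift:
  assumes "E \<in> sets \<mu>"
  shows "measure \<mu> {x \<in> X. shift_map x \<in> E} = measure \<mu> E"
proof -
  have "measure \<mu> E = measure (distr \<mu> \<mu> shift_map) E" by (simp add: distr_shift)
  also have "\<dots> = measure \<mu> (shift_map -` E \<inter> space \<mu>)"
    by (rule measure_distr[OF shift_measurable assms])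
  also have "shift_map -` E \<inter> space \<mu> = {x \<in> X. shift_map x \<in> E}" by (auto simp: space_\<mu>)
  finally show ?thesis ..
qed

lemma shift_pow_sets:
  assumes "E \<in> sets \<mu>"
  shows "{x \<in> X. (shift_map ^^ k) x \<in> E} \<in> sets \<mu>"
proof -
  have "(shift_map ^^ k) \<in> measurable \<mu> \<mu>"
  proof (induction k)
    case (Suc k)
    show ?case using measurable_comp[OF Suc shift_measurable] by (simp add: o_def)
  qed (simp add: id_def)
  from measurable_sets[OF this assms] show ?thesis
    by (simp add: space_\<mu> vimage_def Int_def conj_commute)
qed

lemma measure_shift_pow:
  assumes "E \<in> sets \<mu>"
  shows "measure \<mu> {x \<in> X. (shift_map ^^ k) x \<in> E} = measure \<mu> E"
proof (induction k)
  case 0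
  have "{x \<in> X. x \<in> E} = E" using sets.sets_into_space[OF assms] by (auto simp: space_\<mu>)
  then show ?case by simp
next
  case (Suc k)
  have "{x \<in> X. (shift_map ^^ Suc k) x \<in> E}
      = {x \<in> X. shift_map x \<in> {x \<in> X. (shift_map ^^ k) x \<in> E}}"
    by (auto simp: funpow_Suc_right shift_in simp del: funpow.simps)
  then show ?case using measure_shift[OF shift_pow_sets[OF assms, of k]] Suc by simp
qed

text \<open>Neighbouring sets are preimages of each other under the shift, so invariance propagates
  the measure in both directions along the integers.\<close>

lemma measure_translate:
  assumes meas: "\<And>j. Q j \<in> sets \<mu>" and shift: "\<And>j :: int. Q j = {x \<in> X. shift_map x \<in> Q (j - 1)}"
  shows "measure \<mu> (Q j) = measure \<mu> (Q 0)"
proof -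
  have step: "measure \<mu> (Q (j + 1)) = measure \<mu> (Q j)" for j
    using measure_shift[OF meas[of j]] shift[of "j + 1"] by simp
  show ?thesis
  proof (induction j rule: int_induct[of _ 0])
    case (step2 i)
    then show ?case using step[of "i - 1"] by simp
  qed (simp_all add: step)
qed

section \<open>Measures of tower levels and of passages\<close>

definition level :: "nat \<Rightarrow> int \<Rightarrow> (int \<Rightarrow> nat) set" where
  "level n j = {x \<in> X. cut n x j}"

text \<open>Only the two end cuts are recorded. What matters is that \<open>H n + a\<close> shifts
  carry this set into \<open>level n j\<close>.\<close>

definition passage :: "nat \<Rightarrow> nat \<Rightarrow> int \<Rightarrow> (int \<Rightarrow> nat) set" where
  "passage n a j = {x \<in> X. cut n x j \<and> cut n x (j + int (H n + a))}"

lemma level_sets: "level n j \<in> sets \<mu>"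
  using closed_in_sets[OF closed_cut[of n j]] by (simp add: level_def)

lemma passage_eq: "passage n a j = level n j \<inter> level n (j + int (H n + a))"
  by (auto simp: passage_def level_def)

lemma passage_sets: "passage n a j \<in> sets \<mu>"
  unfolding passage_eq by (intro sets.Int level_sets)

lemma measure_level: "measure \<mu> (level n j) = measure \<mu> (level n 0)"
  by (rule measure_translate[OF level_sets])
    (auto simp: level_def shift_in cut_shift[of n 1, simplified])

lemma measure_passage: "measure \<mu> (passage n a j) = measure \<mu> (passage n a 0)"
  by (rule measure_translate[OF passage_sets])
    (auto simp: passage_def shift_in cut_shift[of n 1, simplified] algebra_simps)

lemma levels_disjoint: "disjoint_family_on (\<lambda>k. level n (- int k)) {..<H n}"
proof -
  have "False" if "x \<in> level n (- int k)" "x \<in> level n (- int k')" "k < k'" "k' < H n" for x k k'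
    using cut_separated[of x n "- int k'" "- int k"] that by (simp add: level_def)
  then show ?thesis unfolding disjoint_family_on_def
    by (metis (no_types, lifting) disjoint_iff lessThan_iff linorder_neqE_nat)
qed

lemma level_measure_le: "real (H n) * measure \<mu> (level n 0) \<le> 1"
proof -
  have "measure \<mu> (\<Union>k\<in>{..<H n}. level n (- int k)) = (\<Sum>k\<in>{..<H n}. measure \<mu> (level n (- int k)))"
    by (rule finite_measure_finite_Union) (auto intro: level_sets levels_disjoint)
  also have "\<dots> = (\<Sum>k\<in>{..<H n}. measure \<mu> (level n 0))"
    by (intro sum.cong refl measure_level)
  also have "\<dots> = real (H n) * measure \<mu> (level n 0)" by simp
  finally show ?thesis using prob_le_1[of "\<Union>k\<in>{..<H n}. level n (- int k)"] by simp
qed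

lemma tower_passage:
  assumes "measure \<mu> (tower q s (Suc n) a) > 0"
  shows "measure \<mu> (tower q s (Suc n) a) \<le> real (H n + a) * measure \<mu> (passage n a 0)"
proof -
  let ?T = "tower q s (Suc n) a"
  \<comment> \<open>A non-measurable set has \<open>measure\<close> 0 by default, so positivity
    gives measurability.\<close>
  have "?T \<in> sets \<mu>" using assms measure_notin_sets by fastforce
  then have TX: "?T \<subseteq> X" using sets.sets_into_space space_\<mu> by blast
  obtain p where cov: "\<And>a. tower q s (Suc n) a \<subseteq>
      (\<Union>k<H n + a. {x. cut n x (- int (p + k)) \<and> cut n x (- int (p + k) + int (H n + a))})"
    using tower_cover[of n] by blast
  have sub: "?T \<subseteq> (\<Union>k\<in>{..<H n + a}. passage n a (- int (p + k)))"
  proof (intro subsetI)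
    fix x assume x: "x \<in> ?T"
    then obtain k where "k < H n + a" "cut n x (- int (p + k))"
      "cut n x (- int (p + k) + int (H n + a))"
      using cov[of a] by blast
    moreover have "x \<in> X" using TX x by blast
    ultimately show "x \<in> (\<Union>k\<in>{..<H n + a}. passage n a (- int (p + k)))"
      by (intro UN_I[of k]) (simp_all only: passage_def lessThan_iff mem_Collect_eq simp_thms)
  qed
  have "measure \<mu> ?T \<le> measure \<mu> (\<Union>k\<in>{..<H n + a}. passage n a (- int (p + k)))"
    by (intro finite_measure_mono[OF sub] sets.finite_UN passage_sets) simp
  also have "\<dots> \<le> (\<Sum>k\<in>{..<H n + a}. measure \<mu> (passage n a (- int (p + k))))"
    by (rule finite_measure_subadditive_finite) (auto intro: passage_sets)
  also have "\<dots> = (\<Sum>k\<in>{..<H n + a}. measure \<mu> (passage n a 0))"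
    by (intro sum.cong refl measure_passage)
  finally show ?thesis by simp
qed

text \<open>Turns a lower bound for the tower into a relative frequency among cuts: the height is at
  most \<open>H n * (B + 1)\<close>, while \<open>H n\<close> times the measure of a level is at
  most 1.\<close>

lemma passage_of_tower:
  assumes c: "0 < c" "c \<le> measure \<mu> (tower q s (Suc n) a)" and a: "a \<le> B"
  shows "c / real (B + 1) * measure \<mu> (level n 0) \<le> measure \<mu> (passage n a 0)"
proof -
  let ?m = "measure \<mu> (level n 0)" and ?e = "measure \<mu> (passage n a 0)"
  have H: "1 \<le> real (H n)" using H_ge[of n] by simp
  have "c * ?m \<le> real (H n + a) * ?e * ?m"
    using tower_passage[of n a] c by (intro mult_right_mono) auto
  also have "real (H n + a) \<le> real (H n) * real (B + 1)"
  proof -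
    have "real B * 1 \<le> real B * real (H n)" using H by (intro mult_left_mono) auto
    then show ?thesis using a by (simp add: algebra_simps)
  qed
  then have "real (H n + a) * ?e * ?m \<le> (real (H n) * real (B + 1)) * ?e * ?m"
    by (intro mult_right_mono) auto
  also have "\<dots> = (real (H n) * ?m) * (real (B + 1) * ?e)" by simp
  also have "\<dots> \<le> 1 * (real (B + 1) * ?e)"
    by (rule mult_right_mono[OF level_measure_le]) simp
  finally show ?thesis by (simp add: field_simps)
qed

text \<open>Density points: a closed set of positive measure almost fills some level of every sufficiently
  high tower, because the levels refine any fixed window of coordinates.\<close>

lemma closed_fills_level:
  assumes K: "closed K" "0 < measure \<mu> (X \<inter> K)" and \<delta>: "0 < \<delta>"
  shows "\<exists>n0. \<forall>n\<ge>n0. \<exists>j. measure \<mu> (level n j - K) < \<delta> * measure \<mu> (level n 0)"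
proof -
  \<comment> \<open>The points of \<open>X\<close> that some point of \<open>K\<close> matches on
    the window of radius \<open>M\<close>; these sets decrease to
    \<open>X \<inter> K\<close>.\<close>
  define C where "C M = {x \<in> X. map x [- int M..int M] \<in> (\<lambda>y. map y [- int M..int M]) ` K}" for M
  define \<kappa> where "\<kappa> = measure \<mu> (X \<inter> K)"
  have Kset: "X \<inter> K \<in> sets \<mu>" using closed_in_sets[OF K(1)] by (simp add: Int_def)
  have diff_sets: "E - K \<in> sets \<mu>" if "E \<in> sets \<mu>" for E
  proof -
    have "E - K = E - X \<inter> K" using sets.sets_into_space[OF that] by (auto simp: space_\<mu>)
    then show ?thesis using Kset that by auto
  qed
  have Cset: "C M \<in> sets \<mu>" for M
    using closed_in_sets[OF closed_window[of "\<lambda>l. l \<in> (\<lambda>y. map y [- int M..int M]) ` K"]]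
    by (simp add: C_def)
  have KC: "X \<inter> K \<subseteq> C M" for M by (auto simp: C_def)
  have restr: "map x [- int M..int M] = map y [- int M..int M]"
    if "map x [- int N..int N] = map y [- int N..int N]" "M \<le> N" for x y :: "int \<Rightarrow> nat" and M N
    using that by auto
  have "decseq C"
    unfolding decseq_def C_def using restr by (auto simp: image_iff)
  moreover have "(\<Inter>M. C M) = X \<inter> K"
  proof
    show "(\<Inter>M. C M) \<subseteq> X \<inter> K"
    proof
      fix x assume x: "x \<in> (\<Inter>M. C M)"
      then have "\<exists>y\<in>K. map x [- int M..int M] = map y [- int M..int M]" for M
        by (auto simp: C_def simp del: map_eq_conv)
      then have "x \<in> K" by (rule closed_agreeing_windows[OF K(1)])
      then show "x \<in> X \<inter> K" using x by (auto simp: C_def)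
    qed
  qed (use KC in blast)
  ultimately have "(\<lambda>M. measure \<mu> (C M)) \<longlonglongrightarrow> \<kappa>"
    using finite_Lim_measure_decseq[of C] Cset by (auto simp: \<kappa>_def)
  moreover have "\<kappa> < \<kappa> + \<delta> * \<kappa> / 2" using K \<delta> by (simp add: \<kappa>_def)
  ultimately have "\<forall>\<^sub>F M in sequentially. measure \<mu> (C M) < \<kappa> + \<delta> * \<kappa> / 2"
    by (rule order_tendstoD(2))
  then obtain M where M: "measure \<mu> (C M) < \<kappa> + \<delta> * \<kappa> / 2"
    by (meson eventually_happens sequentially_bot)
  \<comment> \<open>Large enough that the at most \<open>2 * M + B\<close> exceptional levels in
    \<open>R\<close> below have total measure at most \<open>\<kappa> / 2\<close>.\<close>
  obtain n0 where n0: "2 * real (2 * M + B) / \<kappa> < real n0" using reals_Archimedean2 by blast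
  have "\<exists>j. measure \<mu> (level n j - K) < \<delta> * measure \<mu> (level n 0)" if n: "n \<ge> n0 + 2 * M" for n
  proof (rule ccontr)
    let ?m = "measure \<mu> (level n 0)"
    assume "\<not> ?thesis"
    then have large: "\<delta> * ?m \<le> measure \<mu> (level n j - K)" for j by (simp add: not_less)
    have Hn: "2 * M < H n" "real n0 \<le> real (H n)" using H_ge[of n] n by simp_all
    define J where "J = {k \<in> {M..<H n - M}. level n (- int k) \<subseteq> C M}"
    define R where "R = {..<M} \<union> {H n - M..<H n + B}"
    have cR: "card R \<le> 2 * M + B"
      using card_Un_le[of "{..<M}" "{H n - M..<H n + B}"] Hn by (simp add: R_def)
    have fin: "finite J" "finite R" by (auto simp: J_def R_def)
    \<comment> \<open>For such \<open>k\<close> the window of radius \<open>M\<close> lies inside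
      the copy of \<open>w_n\<close> at \<open>- k\<close>. All points of the level agree on it, so
      the level lies in \<open>C M\<close> or misses it.\<close>
    have dich: "level n (- int k) \<subseteq> C M"
      if k: "k \<in> {M..<H n - M}" and x: "x \<in> level n (- int k)" "x \<in> C M" for k x
    proof
      fix y assume y: "y \<in> level n (- int k)"
      have w: "matches z (- int k) (W n)" if z: "z \<in> level n (- int k)" for z
      proof -
        have "cut n z (- int k)" using z by (simp add: level_def)
        then obtain b where "matches z (- int k) (block (W n) b)" by (rule cut_next)
        then show ?thesis by (simp add: block_def matches_append)
      qed
      have "y i = x i" if i: "i \<in> set [- int M..int M]" for i
      proof -
        define t where "t = nat (i + int k)"
        have t: "i = - int k + int t" "t < length (W n)"
          using i k by (auto simp: t_def H_def[symmetric])
        show ?thesis using matchesD[OF w[OF y] t(2)] matchesD[OF w[OF x(1)] t(2)] t(1) by simp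
      qed
      then have "map y [- int M..int M] = map x [- int M..int M]" by simp
      then show "y \<in> C M" using x(2) y by (simp add: C_def level_def del: map_eq_conv)
    qed
    have cover: "C M \<subseteq> (\<Union>k\<in>J. level n (- int k)) \<union> (\<Union>k\<in>R. level n (- int k))"
    proof
      fix x assume x: "x \<in> C M"
      then have "x \<in> X" by (simp add: C_def)
      then obtain k where k: "k < H n + B" "x \<in> level n (- int k)"
        using cut_near[of x n] by (auto simp: level_def)
      show "x \<in> (\<Union>k\<in>J. level n (- int k)) \<union> (\<Union>k\<in>R. level n (- int k))"
      proof (cases "k \<in> {M..<H n - M}")
        case True
        then show ?thesis using dich[OF True k(2) x] k(2) by (auto simp: J_def)
      next
        case False
        then show ?thesis using k by (auto simp: R_def)
      qed
    qed
    have UJ: "measure \<mu> (\<Union>k\<in>I. level n (- int k)) \<le> real (card I) * ?m" if "finite I" for I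
    proof -
      have "measure \<mu> (\<Union>k\<in>I. level n (- int k)) \<le> (\<Sum>k\<in>I. measure \<mu> (level n (- int k)))"
        using that by (intro finite_measure_subadditive_finite) (auto intro: level_sets)
      also have "\<dots> = (\<Sum>k\<in>I. ?m)" by (intro sum.cong refl measure_level)
      finally show ?thesis by simp
    qed
    have Usets: "(\<Union>k\<in>I. level n (- int k)) \<in> sets \<mu>" if "finite I" for I
      using that by (intro sets.finite_UN level_sets)
    have "\<kappa> \<le> measure \<mu> (C M)" unfolding \<kappa>_def by (rule finite_measure_mono[OF KC Cset])
    also have "\<dots> \<le> measure \<mu> ((\<Union>k\<in>J. level n (- int k)) \<union> (\<Union>k\<in>R. level n (- int k)))"
      using Usets fin by (intro finite_measure_mono[OF cover]) auto
    also have "\<dots> \<le> measure \<mu> (\<Union>k\<in>J. level n (- int k)) + measure \<mu> (\<Union>k\<in>R. level n (- int k))"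
      by (rule measure_Un_le) (use Usets fin in auto)
    also have "\<dots> \<le> real (card J) * ?m + real (card R) * ?m"
      by (intro add_mono UJ fin)
    also have "real (card R) * ?m \<le> real (2 * M + B) * ?m"
      using cR by (intro mult_right_mono) auto
    also have "real (2 * M + B) * ?m \<le> \<kappa> / 2"
    proof -
      have \<kappa>: "\<kappa> > 0" using K by (simp add: \<kappa>_def)
      have "2 * real (2 * M + B) < \<kappa> * real n0"
        using n0 by (simp only: pos_divide_less_eq[OF \<kappa>] mult.commute)
      also have "\<dots> \<le> \<kappa> * real (H n)" using Hn(2) \<kappa> by (intro mult_left_mono) auto
      finally have "2 * real (2 * M + B) \<le> \<kappa> * real (H n)" by (rule less_imp_le)
      then have "2 * real (2 * M + B) * ?m \<le> \<kappa> * real (H n) * ?m" by (rule mult_right_mono) simp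
      also have "\<dots> = \<kappa> * (real (H n) * ?m)" by simp
      also have "\<dots> \<le> \<kappa> * 1" using \<kappa> by (intro mult_left_mono level_measure_le) simp
      finally show ?thesis by (simp add: algebra_simps)
    qed
    finally have half: "\<kappa> / 2 \<le> real (card J) * ?m" by simp
    have disj: "disjoint_family_on (\<lambda>k. level n (- int k) - K) J"
      using levels_disjoint[of n] by (fastforce simp: disjoint_family_on_def J_def)
    \<comment> \<open>The levels in \<open>J\<close> are disjoint, lie in \<open>C M\<close> and
      each lose at least \<open>\<delta> * ?m\<close> outside \<open>K\<close>. Together they exceed
      the measure of \<open>C M - K\<close> allowed by the choice of \<open>M\<close>.\<close>
    have "\<delta> * \<kappa> / 2 \<le> \<delta> * (real (card J) * ?m)"
      using half \<delta> by (simp add: mult_left_mono field_simps)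
    also have "\<dots> = (\<Sum>k\<in>J. \<delta> * ?m)" by simp
    also have "\<dots> \<le> (\<Sum>k\<in>J. measure \<mu> (level n (- int k) - K))" by (intro sum_mono large)
    also have "\<dots> = measure \<mu> (\<Union>k\<in>J. level n (- int k) - K)"
      by (rule finite_measure_finite_Union[symmetric]) (use fin disj diff_sets level_sets in auto)
    also have "\<dots> \<le> measure \<mu> (C M - X \<inter> K)"
      using Cset Kset by (intro finite_measure_mono) (auto simp: J_def)
    also have "\<dots> = measure \<mu> (C M) - \<kappa>"
      unfolding \<kappa>_def by (rule finite_measure_Diff[OF Cset Kset KC])
    finally show False using M by simp
  qed
  then show ?thesis by blast
qed

section \<open>Near-returns of measurable eigenfunctions\<close>

text \<open>If a closed set on which \<open>f\<close> is nearly constant almost fills a level, a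
  passage of relative measure \<open>c\<close> contains a point that starts and ends in that set.
  Comparing the two values of \<open>f\<close> bounds the power of \<open>l\<close>.\<close>

lemma eigenvalue_passage:
  assumes ev: "measurable_eigenvalue \<mu> l" and \<epsilon>: "0 < \<epsilon>" and c: "0 < c"
  shows "\<exists>n0. \<forall>n\<ge>n0. \<forall>a. c * measure \<mu> (level n 0) \<le> measure \<mu> (passage n a 0) \<longrightarrow>
           cmod (l ^ (H n + a) - 1) < \<epsilon>"
proof -
  obtain f :: "(int \<Rightarrow> nat) \<Rightarrow> complex" where f: "f \<in> borel_measurable \<mu>"
    "\<not> (AE x in \<mu>. f x = 0)" "AE x in \<mu>. f (shift_map x) = l * f x"
    using ev by (auto simp: measurable_eigenvalue_def)
  have iter: "AE x in \<mu>. f ((shift_map ^^ k) x) = l ^ k * f x" for k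
  proof (induction k)
    case (Suc k)
    have "AE x in distr \<mu> \<mu> shift_map. f ((shift_map ^^ k) x) = l ^ k * f x"
      unfolding distr_shift by (rule Suc)
    then have "AE x in \<mu>. f ((shift_map ^^ k) (shift_map x)) = l ^ k * f (shift_map x)"
      by (rule AE_distrD[OF shift_measurable])
    then show ?case using f(3)
      by eventually_elim (simp add: funpow_Suc_right del: funpow.simps)
  qed simp
  \<comment> \<open>Closeness is relative to \<open>cmod z\<close>: the bound \<open>1 / 2\<close>
    gives \<open>cmod z \<le> 2 * cmod (f x)\<close>, and \<open>\<epsilon> / 8\<close> absorbs the
    factor 4 of the final estimate.\<close>
  define \<eta> where "\<eta> = min (1 / 2) (\<epsilon> / 8)"
  have \<eta>: "0 < \<eta>" "\<eta> \<le> 1 / 2" "\<eta> \<le> \<epsilon> / 8" using \<epsilon> by (auto simp: \<eta>_def)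
  define S where "S z = {x \<in> space \<mu>. cmod (f x - z) < \<eta> * cmod z}" for z
  have Sset: "S z \<in> sets \<mu>" for z unfolding S_def using f(1) by measurable
  \<comment> \<open>As \<open>z\<close> runs through a countable dense set, the sets
    \<open>S z\<close> cover the points where \<open>f\<close> is nonzero, so not all of them are
    null.\<close>
  obtain z where z: "measure \<mu> (S z) > 0"
  proof (rule ccontr)
    assume "\<not> thesis"
    then have null: "S z \<in> null_sets \<mu>" for z
      using that Sset by (metis emeasure_eq_measure ennreal_0 measure_nonneg null_setsI order_le_less)
    obtain D :: "complex set" where D: "countable D"
      "\<And>Y. open Y \<Longrightarrow> Y \<noteq> {} \<Longrightarrow> \<exists>d\<in>D. d \<in> Y"
      by (rule countable_dense_setE) blast
    have "(\<Union>z\<in>D. S z) \<in> null_sets \<mu>" using D(1) null by (intro null_sets_UN') auto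
    moreover have "{x \<in> space \<mu>. f x \<noteq> 0} \<subseteq> (\<Union>z\<in>D. S z)"
    proof safe
      fix x assume x: "x \<in> space \<mu>" "f x \<noteq> 0"
      obtain d where d: "d \<in> D" "d \<in> ball (f x) (\<eta> / 2 * cmod (f x))"
      proof -
        have "0 < \<eta> / 2 * cmod (f x)" using x \<eta> by simp
        then have "ball (f x) (\<eta> / 2 * cmod (f x)) \<noteq> {}" by (simp only: ball_eq_empty not_le)
        then show ?thesis using D(2)[OF open_ball] that by blast
      qed
      then have lt: "cmod (f x - d) < \<eta> / 2 * cmod (f x)" by (simp add: dist_norm)
      also have "\<dots> \<le> 1 / 2 * cmod (f x)" using \<eta> by (intro mult_right_mono) auto
      finally have "cmod (f x) \<le> 2 * cmod d" using norm_triangle_ineq2[of "f x" d] by simp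
      then have "\<eta> / 2 * cmod (f x) \<le> \<eta> / 2 * (2 * cmod d)" using \<eta> by (intro mult_left_mono) auto
      with lt have "cmod (f x - d) < \<eta> * cmod d" by simp
      then show "x \<in> (\<Union>z\<in>D. S z)" using d(1) x by (auto simp: S_def)
    qed
    ultimately have "AE x in \<mu>. f x = 0" by (auto intro: AE_I')
    then show False using f(2) by blast
  qed
  \<comment> \<open>\<open>S z\<close> is only Borel, whereas \<open>closed_fills_level\<close>
    requires a closed set; one of positive measure inside \<open>S z\<close> is now
    constructed.\<close>
  have S': "\<exists>S'\<in>sets borel. S z = X \<inter> S'"
    using Sset[of z] unfolding sets_\<mu> sets_restrict_space by auto
  then obtain S' where S': "S' \<in> sets borel" "S z = X \<inter> S'" by blast
  \<comment> \<open>Inner regularity needs a complete metric space, but \<open>nat\<close> is not an instance of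
    \<open>metric_space\<close>; so the measure is transported to real-valued sequences.\<close>
  define e :: "(int \<Rightarrow> nat) \<Rightarrow> int \<Rightarrow> real" where "e x i = real (x i)" for x i
  define g :: "(int \<Rightarrow> real) \<Rightarrow> int \<Rightarrow> nat" where "g y i = nat \<lfloor>y i\<rfloor>" for y i
  have ge: "g (e x) = x" for x by (rule ext) (simp add: g_def e_def)
  have cont: "continuous_on UNIV e"
  proof (rule continuous_on_coordinatewise_then_product)
    fix i show "continuous_on UNIV (\<lambda>x. e x i)"
      unfolding e_def by (rule continuous_on_compose2[of UNIV real]) (auto simp: continuous_on_discrete)
  qed
  then have e: "e \<in> measurable \<mu> borel"
    by (simp add: measurable_cong_sets[OF sets_\<mu> refl] measurable_restrict_space1
        borel_measurable_continuous_onI)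
  have "g \<in> borel_measurable borel"
    unfolding g_def by (rule measurable_coordinatewise_then_product) measurable
  from measurable_sets[OF this S'(1)] have T: "g -` S' \<in> sets borel" by simp
  define \<nu> where "\<nu> = distr \<mu> borel e"
  have \<nu>: "emeasure \<nu> E = emeasure \<mu> (X \<inter> e -` E)" if "E \<in> sets borel" for E
    unfolding \<nu>_def using that e by (simp add: emeasure_distr space_\<mu> Int_commute)
  have "e -` g -` S' = S'" by (auto simp: ge)
  then have "0 < emeasure \<nu> (g -` S')" using z S' \<nu>[OF T] by (simp add: emeasure_eq_measure)
  also have "emeasure \<nu> (g -` S') = (SUP K \<in> {K. K \<subseteq> g -` S' \<and> compact K}. emeasure \<nu> K)"
    using T \<nu>[of UNIV] by (intro inner_regular) (auto simp: \<nu>_def emeasure_eq_measure)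
  finally obtain K' where K': "K' \<subseteq> g -` S'" "compact K'" "0 < emeasure \<nu> K'"
    by (auto simp: less_SUP_iff)
  define K where "K = e -` K'"
  have K: "K \<subseteq> S'" "closed K"
    using K'(1) ge closed_vimage[OF compact_imp_closed[OF K'(2)] cont] by (force simp: K_def)+
  have "K' \<in> sets borel" using K'(2) by (simp add: borel_compact)
  then have "0 < measure \<mu> (X \<inter> K)" using K'(3) \<nu>[of K'] by (simp add: emeasure_eq_measure K_def)
  \<comment> \<open>Two exceptional sets have to be removed from the passage, one at its start and
    one at its end, hence half of \<open>c\<close> for each.\<close>
  from closed_fills_level[OF K(2) this, of "c / 2"] c obtain n0 where
    n0: "\<And>n. n \<ge> n0 \<Longrightarrow> \<exists>j. measure \<mu> (level n j - K) < c / 2 * measure \<mu> (level n 0)" by auto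
  have KS: "x \<in> S z" if "x \<in> X" "x \<in> K" for x using that K(1) S'(2) by blast
  have "cmod (l ^ (H n + a) - 1) < \<epsilon>"
    if n: "n \<ge> n0" and large: "c * measure \<mu> (level n 0) \<le> measure \<mu> (passage n a 0)" for n a
  proof (rule ccontr)
    assume far: "\<not> ?thesis"
    let ?k = "H n + a" and ?m = "measure \<mu> (level n 0)"
    obtain j where j: "measure \<mu> (level n j - K) < c / 2 * ?m" using n0[OF n] by blast
    have Kset: "X \<inter> K \<in> sets \<mu>" using closed_in_sets[OF K(2)] by (simp add: Int_def)
    define E where "E = level n j - K"
    have "E = level n j - X \<inter> K" by (auto simp: E_def level_def)
    then have Eset: "E \<in> sets \<mu>" using Kset level_sets by auto
    \<comment> \<open>The points whose return misses \<open>K\<close>. A point of the passage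
      outside \<open>E\<close> and \<open>E'\<close> has both ends in \<open>S z\<close>, which
      almost surely contradicts \<open>far\<close>.\<close>
    define E' where "E' = {x \<in> X. (shift_map ^^ ?k) x \<in> E}"
    have E': "E' \<in> sets \<mu>" "measure \<mu> E' = measure \<mu> E"
      unfolding E'_def by (rule shift_pow_sets[OF Eset], rule measure_shift_pow[OF Eset])
    have "AE x in \<mu>. x \<in> passage n a j \<longrightarrow> x \<in> E \<union> E'"
      using iter[of ?k]
    proof eventually_elim
      case (elim x)
      let ?y = "(shift_map ^^ ?k) x"
      show ?case
      proof (rule impI, rule ccontr)
        assume p: "x \<in> passage n a j" and no: "x \<notin> E \<union> E'"
        then have x: "x \<in> X" "x \<in> level n j" by (auto simp: passage_def level_def)
        have y: "?y \<in> X" "?y \<in> level n j"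
          using p shift_pow_in[of x ?k] by (auto simp: passage_def level_def cut_shift)
        have "x \<in> S z" "?y \<in> S z" using no x y KS by (auto simp: E_def E'_def)
        then have near: "cmod (f x - z) < \<eta> * cmod z" "cmod (f ?y - z) < \<eta> * cmod z"
          by (auto simp: S_def)
        have "\<eta> * cmod z \<le> 1 / 2 * cmod z" using \<eta> by (intro mult_right_mono) auto
        moreover have "cmod z \<le> cmod (f x) + cmod (f x - z)"
          using norm_triangle_ineq4[of "f x" "f x - z"] by simp
        ultimately have zf: "cmod z \<le> 2 * cmod (f x)" using near(1) by linarith
        have f0: "f x \<noteq> 0"
        proof
          assume "f x = 0"
          then have "cmod z \<le> 0" using zf by simp
          then show False using near(1) by simp
        qed
        have "cmod (l ^ ?k - 1) * cmod (f x) = cmod (f ?y - f x)"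
          unfolding norm_mult[symmetric] elim by (simp add: algebra_simps)
        also have "\<dots> \<le> cmod (f ?y - z) + cmod (f x - z)"
          using norm_triangle_ineq4[of "f ?y - z" "f x - z"] by simp
        also have "\<dots> < 2 * \<eta> * cmod z" using near by simp
        also have "\<dots> \<le> 2 * \<eta> * (2 * cmod (f x))" using zf \<eta> by (intro mult_left_mono) auto
        also have "\<dots> \<le> \<epsilon> * cmod (f x)"
        proof -
          have "4 * \<eta> \<le> \<epsilon>" using \<eta> \<epsilon> by simp
          then show ?thesis using mult_right_mono[of "4 * \<eta>" \<epsilon> "cmod (f x)"] by simp
        qed
        finally have "cmod (l ^ ?k - 1) < \<epsilon>" using f0 by simp
        then show False using far by simp
      qed
    qed
    then have "measure \<mu> (passage n a j) \<le> measure \<mu> (E \<union> E')"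
      using Eset E'(1) by (intro finite_measure_mono_AE) auto
    also have "\<dots> \<le> measure \<mu> E + measure \<mu> E'"
      by (rule measure_Un_le[OF Eset E'(1)])
    also have "\<dots> < c * ?m" using j unfolding E'(2) E_def by simp
    finally show False using large measure_passage[of n a j] by simp
  qed
  then show ?thesis by blast
qed

section \<open>Consequences of cleanness\<close>

lemma clean_eigenvalue_limit:
  assumes lv: "contraction_levels lv" and clean: "clean_along q s \<mu> lv A"
    and ev: "measurable_eigenvalue \<mu> l" and \<epsilon>: "0 < \<epsilon>"
  shows "\<exists>n. Suc n \<ge> stab_level q s \<and> (\<forall>a\<in>A. cmod (l ^ (H n + a) - 1) < \<epsilon>)"
proof -
  obtain c where A: "A \<subseteq> eventual_alphabet q s" and c: "0 < c"
    "\<And>k a. lv k \<ge> stab_level q s \<Longrightarrow> a \<in> A \<Longrightarrow> c \<le> measure \<mu> (tower q s (lv k) a)"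
    using clean by (auto simp: clean_along_def)
  have "0 < c / real (B + 1)" using c(1) by simp
  from eigenvalue_passage[OF ev \<epsilon> this] obtain n0 where
    n0: "\<And>n a. n \<ge> n0 \<Longrightarrow> c / real (B + 1) * measure \<mu> (level n 0) \<le> measure \<mu> (passage n a 0)
      \<Longrightarrow> cmod (l ^ (H n + a) - 1) < \<epsilon>" by blast
  \<comment> \<open>Since \<open>k \<le> lv k\<close>, this level is beyond both thresholds. Towers
    of level \<open>Suc n\<close> correspond to passages of level \<open>n\<close>, hence the
    successor.\<close>
  define k where "k = Suc n0 + stab_level q s"
  have "k \<le> lv k" using lv by (simp add: contraction_levels_def strict_mono_imp_increasing)
  then have k: "Suc n0 \<le> lv k" "stab_level q s \<le> lv k" by (simp_all add: k_def)
  then obtain n where n: "lv k = Suc n" "n0 \<le> n" by (metis Suc_le_D Suc_le_mono)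
  have "cmod (l ^ (H n + a) - 1) < \<epsilon>" if "a \<in> A" for a
  proof (rule n0[OF n(2)], rule passage_of_tower[OF c(1)])
    show "c \<le> measure \<mu> (tower q s (Suc n) a)" using c(2)[OF k(2) that] n by simp
    have "a \<in> Al n" using that A alphabet_eventually(2)[of "Suc n"] k(2) n(1) by auto
    then show "a \<le> B" by (rule Al_le)
  qed
  then show ?thesis using k(2) n(1) by auto
qed

text \<open>The powers of \<open>l\<close> at \<open>H n + a\<close> and \<open>H n + b\<close> are
  both nearly 1, and their quotient does not depend on \<open>n\<close>.\<close>

lemma clean_eigenvalue_differences:
  assumes "contraction_levels lv" "clean_along q s \<mu> lv A" "measurable_eigenvalue \<mu> l"
    and ab: "a \<in> A" "b \<in> A" "a < b"
  shows "l ^ (b - a) = 1"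
proof -
  have "cmod (l ^ (b - a) - 1) \<le> \<epsilon>" if "0 < \<epsilon>" for \<epsilon>
  proof -
    define \<eta> where "\<eta> = min (1 / 2) (\<epsilon> / 4)"
    have \<eta>: "0 < \<eta>" "\<eta> \<le> 1 / 2" "\<eta> \<le> \<epsilon> / 4" using that by (auto simp: \<eta>_def)
    obtain n where n: "\<And>a. a \<in> A \<Longrightarrow> cmod (l ^ (H n + a) - 1) < \<eta>"
      using clean_eigenvalue_limit[OF assms(1-3) \<eta>(1)] by blast
    let ?u = "l ^ (H n + a)"
    have eq: "l ^ (H n + b) = ?u * l ^ (b - a)" using ab(3) by (simp flip: power_add)
    \<comment> \<open>Being within \<open>1 / 2\<close> of 1, this power can be divided out at the
      cost of a factor 2, without appeal to the modulus of \<open>l\<close>.\<close>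
    have u: "1 / 2 \<le> cmod ?u"
      using n[OF ab(1)] \<eta>(2) norm_triangle_ineq2[of 1 "1 - ?u"] by (simp add: norm_minus_commute)
    have "1 / 2 * cmod (l ^ (b - a) - 1) \<le> cmod ?u * cmod (l ^ (b - a) - 1)"
      by (rule mult_right_mono[OF u]) simp
    also have "\<dots> = cmod ((l ^ (H n + b) - 1) - (?u - 1))"
      unfolding eq norm_mult[symmetric] by (simp add: algebra_simps)
    also have "\<dots> \<le> cmod (l ^ (H n + b) - 1) + cmod (?u - 1)" by (rule norm_triangle_ineq4)
    finally show ?thesis using n[OF ab(1)] n[OF ab(2)] \<eta>(3) by simp
  qed
  then have "cmod (l ^ (b - a) - 1) \<le> 0" by (rule field_le_epsilon[of _ 0, simplified])
  then show ?thesis by simp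
qed

text \<open>Two recurring spacers make \<open>l\<close> a root of unity, so its powers form a finite
  set in which being close to 1 means being 1. This makes the block condition exact at some
  level.\<close>

lemma exact_rank_continuous_eigenvalue:
  assumes "contraction_levels lv" "clean_along q s \<mu> lv (eventual_alphabet q s)"
    "measurable_eigenvalue \<mu> l"
  shows "continuous_eigenvalue X l"
proof -
  let ?E = "eventual_alphabet q s"
  have E: "Al n = ?E" if "Suc n \<ge> stab_level q s" for n using alphabet_eventually(2)[OF that] .
  then have "\<exists>a\<in>?E. \<exists>b\<in>?E. a \<noteq> b" using two_spacers[of "stab_level q s"] by simp
  then obtain a b where ab: "a \<in> ?E" "b \<in> ?E" "a < b" by (metis linorder_neqE_nat)
  define d where "d = b - a"
  have d: "0 < d" "l ^ d = 1"
    using clean_eigenvalue_differences[OF assms ab] ab(3) by (simp_all add: d_def)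
  have "finite {z :: complex. z ^ d = 1}" using d(1) by (intro finite_roots_unity) simp
  \<comment> \<open>\<open>\<epsilon>\<close> isolates 1 from the other \<open>d\<close>-th roots of
    unity.\<close>
  from finite_set_avoid[OF this, of 1] obtain \<epsilon> where \<epsilon>: "0 < \<epsilon>"
    "\<forall>z\<in>{z :: complex. z ^ d = 1}. z \<noteq> 1 \<longrightarrow> \<epsilon> \<le> dist 1 z" by blast
  obtain n where n: "Suc n \<ge> stab_level q s" "\<And>a. a \<in> ?E \<Longrightarrow> cmod (l ^ (H n + a) - 1) < \<epsilon>"
    using clean_eigenvalue_limit[OF assms \<epsilon>(1)] by blast
  have "l ^ (H n + c) = 1" if "c \<in> ?E" for c
  proof (rule ccontr)
    assume "l ^ (H n + c) \<noteq> 1"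
    moreover have "(l ^ (H n + c)) ^ d = 1"
      by (metis d(2) power_commutes power_mult mult.commute power_one)
    ultimately have "\<epsilon> \<le> dist 1 (l ^ (H n + c))" using \<epsilon>(2) by blast
    then show False using n(2)[OF that] by (simp add: dist_norm norm_minus_commute)
  qed
  then show ?thesis using E[OF n(1)] by (intro continuous_eigenvalue_of_blocks[of n]) simp
qed

end

lemma rational_of_root_of_unity:
  assumes "exp (2 * complex_of_real pi * \<i> * complex_of_real \<alpha>) ^ d = 1" "0 < d"
  shows "\<alpha> \<in> \<rat>"
proof -
  have "exp (of_nat d * (2 * complex_of_real pi * \<i> * complex_of_real \<alpha>)) = 1"
    using assms(1) by (simp add: exp_of_nat_mult)
  then obtain n :: int where "real d * (2 * pi * \<alpha>) = of_int (2 * n) * pi"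
    by (auto simp: exp_eq_1)
  then have "\<alpha> = of_int n / real d" using assms(2) by (simp add: field_simps)
  then show ?thesis by simp
qed

theorem corollary5p4:
  fixes q :: "nat \<Rightarrow> nat" and s :: "nat \<Rightarrow> nat \<Rightarrow> nat"
    and \<mu> :: "(int \<Rightarrow> nat) measure"
    and lv :: "nat \<Rightarrow> nat" and A\<^sub>\<mu> :: "nat set"
  assumes "standard q"
    and "bounded_spacers q s"
    and "aperiodic (ferenczi_subshift q s)"
    and "invariant_prob (ferenczi_subshift q s) \<mu>"
    and "contraction_levels lv"
    and "clean_along q s \<mu> lv A\<^sub>\<mu>"
  shows "(card A\<^sub>\<mu> = card (eventual_alphabet q s) \<longrightarrow>
            (\<forall>l. measurable_eigenvalue \<mu> l \<longrightarrow> continuous_eigenvalue (ferenczi_subshift q s) l))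
       \<and> (card A\<^sub>\<mu> \<ge> 2 \<longrightarrow>
            \<not> (\<exists>\<alpha>::real. \<alpha> \<notin> \<rat> \<and>
                 measurable_eigenvalue \<mu> (exp (2 * complex_of_real pi * \<i> * complex_of_real \<alpha>))))"
proof -
  obtain B where B: "\<And>n i. i < q n \<Longrightarrow> s n i \<le> B"
    using assms(2) by (auto simp: bounded_spacers_def)
  interpret ferenczi_measure q s B \<mu>
    using assms(1,3,4) B by unfold_locales auto
  have sub: "A\<^sub>\<mu> \<subseteq> eventual_alphabet q s" using assms(6) by (simp add: clean_along_def)
  have fin: "finite (eventual_alphabet q s)"
    using finite_Al[of "stab_level q s"] alphabet_eventually(2)[of "Suc (stab_level q s)"] by simp
  show ?thesis
  proof (intro conjI impI allI notI)
    fix l assume "card A\<^sub>\<mu> = card (eventual_alphabet q s)" and ev: "measurable_eigenvalue \<mu> l"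
    then have "A\<^sub>\<mu> = eventual_alphabet q s" using card_subset_eq[OF fin sub] by blast
    then show "continuous_eigenvalue (ferenczi_subshift q s) l"
      using exact_rank_continuous_eigenvalue assms(5,6) ev by blast
  next
    assume "card A\<^sub>\<mu> \<ge> 2"
      and "\<exists>\<alpha>::real. \<alpha> \<notin> \<rat> \<and>
        measurable_eigenvalue \<mu> (exp (2 * complex_of_real pi * \<i> * complex_of_real \<alpha>))"
    then obtain \<alpha> :: real where \<alpha>: "\<alpha> \<notin> \<rat>"
      "measurable_eigenvalue \<mu> (exp (2 * complex_of_real pi * \<i> * complex_of_real \<alpha>))" by blast
    have "\<exists>a\<in>A\<^sub>\<mu>. \<exists>b\<in>A\<^sub>\<mu>. a \<noteq> b"
    proof (rule ccontr)
      assume "\<not> ?thesis"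
      then have "card A\<^sub>\<mu> \<le> 1"
        by (cases "A\<^sub>\<mu> = {}") (auto intro!: card_le_Suc0_iff_eq[THEN iffD2] finite_subset[OF sub fin])
      then show False using \<open>card A\<^sub>\<mu> \<ge> 2\<close> by simp
    qed
    then obtain a b where "a \<in> A\<^sub>\<mu>" "b \<in> A\<^sub>\<mu>" "a < b" by (metis linorder_neqE_nat)
    \<comment> \<open>The difference \<open>b - a\<close> makes the exponential a root of unity,
      which forces \<open>\<alpha>\<close> to be rational.\<close>
    then show False
      using clean_eigenvalue_differences[OF assms(5,6) \<alpha>(2)] rational_of_root_of_unity[of \<alpha> "b - a"] \<alpha>(1)
      by simp
  qed
qed

end
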